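(* Let $(M,J,h)$ be a Hermitian surface. The almost complex structures $\mathbb{J}_i^{Ch}$, $i=1,2,3,4$, on $Z=\mathbb{P}(T^{1,0}M)$ induced by the Chern connection are all conformally invariant: for every smooth real function $f$ on $M$ and every $i\in\{1,2,3,4\}$, the almost complex structure $\mathbb{J}_i^{Ch}$ on $Z$ constructed from $(M,J,e^{2f}h)$ coincides with the one constructed from $(M,J,h)$.
   Context: A Hermitian surface $(M,J,h)$ is a complex manifold of real dimension $4$ with (integrable) complex structure $J$ and a $J$-compatible Riemannian metric $h$. Unitary frames. Let $\pi:Q=U(M)\to M$ be the principal $U(2)$-bundle of ($h$-)unitary frames; its points are pairs $(u_1,u_2)$ with $u_1=\frac{1}{\sqrt2}(e_1-\sqrt{-1}e_2)$, $u_2=\frac{1}{\sqrt2}(e_3-\sqrt{-1}e_4)$, where $(e_1,e_2=Je_1,e_3,e_4=Je_3)$ is an $h$-orthonormal frame of $T_xM$. The canonical $\mathbb{C}^2$-valued $1$-form $(\varphi^1,\varphi^2)^t$ on $Q$ is defined by $\pi_*X=\sum_a\varphi^a(X)u_a+\sum_a\overline{\varphi^a(X)}\,\overline{u_a}$ for $X\in T_{(u_1,u_2)}Q$. A Hermitian connection $D$ (i.e. $Dh=0$, $DJ=0$) is given by a $\mathfrak{u}(2)$-valued connection form on $Q$. The Chern connection is the unique Hermitian connection whose torsion has vanishing $(1,1)$-part; its connection form $(\psi^a_b)$ is given by $Du_b=\sum_a\psi^a_b\,u_a$ for local unitary frames. Twistor space. Let $Z=\mathbb{P}(T^{1,0}M)$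 be the bundle of complex lines in $T^{1,0}M$ (it depends only on $(M,J)$), and let $\pi_1:Q\to Z$, $\pi_1((u_1,u_2))=\mathrm{Span}_{\mathbb{C}}\{u_1\}$. Put $\varphi^3=\psi^1_2$. For a local section $u$ of $\pi_1:Q\to Z$, the forms $u^*\varphi^1,u^*\varphi^2,u^*\varphi^3$ and their conjugates form a local basis of complex $1$-forms on $Z$ (the pull-back $u^*$ is omitted from the notation). Changing the section multiplies each of $\varphi^1,\varphi^2,\varphi^3$ by a unit-modulus function, so the following almost complex structures on $Z$ are well defined by their local bases of $(1,0)$-forms: $\mathbb{J}_1^{Ch}:\{\varphi^1,\overline{\varphi^2},\varphi^3\}$; $\mathbb{J}_2^{Ch}:\{\varphi^1,\overline{\varphi^2},\overline{\varphi^3}\}$; $\mathbb{J}_3^{Ch}:\{\varphi^1,\varphi^2,\varphi^3\}$; $\mathbb{J}_4^{Ch}:\{\varphi^1,\varphi^2,\overline{\varphi^3}\}$. *)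

theory Defs
  imports "HOL-Analysis.Analysis"
begin

section \<open>Smooth manifolds given by an atlas\<close>

primrec Ck_on :: "nat \<Rightarrow> 'a::real_normed_vector set \<Rightarrow> ('a \<Rightarrow> 'b::real_normed_vector) \<Rightarrow> bool" where
  "Ck_on 0 S f = continuous_on S f"
| "Ck_on (Suc k) S f =
     (f differentiable_on S \<and> (\<forall>v. Ck_on k S (\<lambda>x. frechet_derivative f (at x) v)))"

text \<open>Only used for open \<open>S\<close> in Euclidean spaces, where it means \<open>C\<^sup>\<infinity>\<close>.\<close>

definition smooth_on :: "'a::real_normed_vector set \<Rightarrow> ('a \<Rightarrow> 'b::real_normed_vector) \<Rightarrow> bool" where
  "smooth_on S f \<longleftrightarrow> (\<forall>k. Ck_on k S f)"

text \<open>A chart is a domain together with a coordinate map; values of the map off the domain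
  are irrelevant.\<close>

type_synonym ('m, 'e) chart = "'m set \<times> ('m \<Rightarrow> 'e)"

abbreviation dom_ch :: "('m, 'e) chart \<Rightarrow> 'm set" where "dom_ch \<equiv> fst"
abbreviation map_ch :: "('m, 'e) chart \<Rightarrow> 'm \<Rightarrow> 'e" where "map_ch \<equiv> snd"

definition inv_ch :: "('m, 'e) chart \<Rightarrow> 'e \<Rightarrow> 'm" where
  "inv_ch c = the_inv_into (dom_ch c) (map_ch c)"

definition carrier_of :: "('m, 'e) chart set \<Rightarrow> 'm set" where
  "carrier_of A = (\<Union>c\<in>A. dom_ch c)"

text \<open>The underlying set is the union of the chart domains and its topology is the one for
  which all charts are homeomorphisms onto open sets.\<close>

definition smooth_atlas :: "('m, 'e::euclidean_space) chart set \<Rightarrow> bool" where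
  "smooth_atlas A \<longleftrightarrow>
     (\<forall>c\<in>A. inj_on (map_ch c) (dom_ch c) \<and> open (map_ch c ` dom_ch c)) \<and>
     (\<forall>c\<in>A. \<forall>d\<in>A. open (map_ch c ` (dom_ch c \<inter> dom_ch d)) \<and>
        smooth_on (map_ch c ` (dom_ch c \<inter> dom_ch d)) (map_ch d \<circ> inv_ch c))"

definition atlas_topology :: "('m, 'e::euclidean_space) chart set \<Rightarrow> 'm topology" where
  "atlas_topology A = topology (\<lambda>W. W \<subseteq> carrier_of A \<and>
     (\<forall>c\<in>A. open (map_ch c ` (W \<inter> dom_ch c))))"

definition smooth_fun ::
  "('m, 'e::euclidean_space) chart set \<Rightarrow> 'm set \<Rightarrow> ('m \<Rightarrow> 'b::real_normed_vector) \<Rightarrow> bool" where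
  "smooth_fun A W f \<longleftrightarrow> (\<forall>c\<in>A. smooth_on (map_ch c ` (W \<inter> dom_ch c)) (f \<circ> inv_ch c))"

subsection \<open>Tangent vectors\<close>

text \<open>One chart is chosen around every point \<open>p\<close>, and a tangent vector at \<open>p\<close> is represented
  by its coordinate vector in that chart. So \<open>T\<^sub>p M\<close> is the model space, for every \<open>p\<close>; the
  identification with the coordinate vectors in any other chart is \<open>tcoord\<close>, with inverse
  \<open>tvec\<close>.\<close>

definition chart_at :: "('m, 'e) chart set \<Rightarrow> 'm \<Rightarrow> ('m, 'e) chart" where
  "chart_at A p = (SOME c. c \<in> A \<and> p \<in> dom_ch c)"

definition mderiv :: "('n, 'd::euclidean_space) chart set \<Rightarrow> ('m, 'e::euclidean_space) chart set
    \<Rightarrow> ('n \<Rightarrow> 'm) \<Rightarrow> 'n \<Rightarrow> 'd \<Rightarrow> 'e" where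
  "mderiv B A g n = frechet_derivative (map_ch (chart_at A (g n)) \<circ> g \<circ> inv_ch (chart_at B n))
     (at (map_ch (chart_at B n) n))"

definition dir_deriv :: "('m, 'e::euclidean_space) chart set \<Rightarrow> 'm \<Rightarrow> 'e
    \<Rightarrow> ('m \<Rightarrow> 'b::real_normed_vector) \<Rightarrow> 'b" where
  "dir_deriv A p X f =
     frechet_derivative (f \<circ> inv_ch (chart_at A p)) (at (map_ch (chart_at A p) p)) X"

definition tcoord ::
  "('m, 'e::euclidean_space) chart set \<Rightarrow> ('m, 'e) chart \<Rightarrow> 'm \<Rightarrow> 'e \<Rightarrow> 'e" where
  "tcoord A c p X = dir_deriv A p X (map_ch c)"

text \<open>For fixed \<open>v\<close>, \<open>\<lambda>p. tvec A c p v\<close> is the vector field on the domain of \<open>c\<close> with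
  constant \<open>c\<close>-coordinates \<open>v\<close>.\<close>

definition tvec ::
  "('m, 'e::euclidean_space) chart set \<Rightarrow> ('m, 'e) chart \<Rightarrow> 'm \<Rightarrow> 'e \<Rightarrow> 'e" where
  "tvec A c p v = frechet_derivative (map_ch (chart_at A p) \<circ> inv_ch c) (at (map_ch c p)) v"

text \<open>Smooth vector fields along a map \<open>g\<close>, i.e. smooth sections over \<open>W\<close> of the pull-back of
  the tangent bundle by \<open>g\<close>.\<close>

definition smooth_along :: "('n, 'd::euclidean_space) chart set
    \<Rightarrow> ('m, 'e::euclidean_space) chart set \<Rightarrow> ('n \<Rightarrow> 'm) \<Rightarrow> 'n set \<Rightarrow> ('n \<Rightarrow> 'e) \<Rightarrow> bool" where
  "smooth_along B A g W Y \<longleftrightarrow>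
     (\<forall>c\<in>A. smooth_fun B (W \<inter> g -` dom_ch c) (\<lambda>n. tcoord A c (g n) (Y n)))"

definition smooth_vfield ::
  "('m, 'e::euclidean_space) chart set \<Rightarrow> 'm set \<Rightarrow> ('m \<Rightarrow> 'e) \<Rightarrow> bool" where
  "smooth_vfield A W Y \<longleftrightarrow> smooth_along A A (\<lambda>p. p) W Y"

definition lie_bracket ::
  "('m, 'e::euclidean_space) chart set \<Rightarrow> ('m \<Rightarrow> 'e) \<Rightarrow> ('m \<Rightarrow> 'e) \<Rightarrow> 'm \<Rightarrow> 'e" where
  "lie_bracket A X Y p =
     dir_deriv A p (X p) (\<lambda>q. tcoord A (chart_at A p) q (Y q)) -
     dir_deriv A p (Y p) (\<lambda>q. tcoord A (chart_at A p) q (X q))"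

subsection \<open>Connections\<close>

text \<open>\<open>D p X Y\<close> is \<open>(D\<^sub>X Y)(p)\<close> for \<open>X\<close> a tangent vector at \<open>p\<close> and \<open>Y\<close> a vector field defined
  and smooth on some open neighbourhood \<open>W\<close> of \<open>p\<close>; it depends only on \<open>Y\<close> near \<open>p\<close>.\<close>

type_synonym ('m, 'e) conn = "'m \<Rightarrow> 'e \<Rightarrow> ('m \<Rightarrow> 'e) \<Rightarrow> 'e"

definition connection :: "('m, 'e::euclidean_space) chart set \<Rightarrow> ('m, 'e) conn \<Rightarrow> bool" where
  "connection A D \<longleftrightarrow>
    (\<forall>W Y. openin (atlas_topology A) W \<and> smooth_vfield A W Y \<longrightarrow>
       (\<forall>p\<in>W. linear (\<lambda>X. D p X Y)) \<and>
       (\<forall>Y'. smooth_vfield A W Y' \<longrightarrow>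
          (\<forall>p\<in>W. \<forall>X. D p X (\<lambda>q. Y q + Y' q) = D p X Y + D p X Y')) \<and>
       (\<forall>f :: 'm \<Rightarrow> real. smooth_fun A W f \<longrightarrow>
          (\<forall>p\<in>W. \<forall>X. D p X (\<lambda>q. f q *\<^sub>R Y q) = dir_deriv A p X f *\<^sub>R Y p + f p *\<^sub>R D p X Y)) \<and>
       (\<forall>Y'. (\<forall>q\<in>W. Y' q = Y q) \<longrightarrow> (\<forall>p\<in>W. \<forall>X. D p X Y' = D p X Y)) \<and>
       (\<forall>X. smooth_vfield A W X \<longrightarrow> smooth_vfield A W (\<lambda>p. D p (X p) Y)))"

definition torsion :: "('m, 'e::euclidean_space) chart set \<Rightarrow> ('m, 'e) conn
    \<Rightarrow> ('m \<Rightarrow> 'e) \<Rightarrow> ('m \<Rightarrow> 'e) \<Rightarrow> 'm \<Rightarrow> 'e" where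
  "torsion A D X Y p = D p (X p) Y - D p (Y p) X - lie_bracket A X Y p"

text \<open>The pull-back connection: the covariant derivative at \<open>n\<close> in direction \<open>X\<close> of a vector
  field \<open>Y\<close> along \<open>g\<close>. In coordinates around \<open>g n\<close> one has
  \<open>Y = (\<Sum>b\<in>Basis. Y\<^sup>b \<cdot> E\<^sub>b)\<close> with the coordinate fields \<open>E\<^sub>b\<close>, and the value is
  \<open>\<Sum>b\<in>Basis. X(Y\<^sup>b) \<cdot> E\<^sub>b + Y\<^sup>b \<cdot> D\<^bsub>dg(X)\<^esub> E\<^sub>b\<close>. This does not depend on the coordinates.\<close>

definition cov_along :: "('n, 'd::euclidean_space) chart set \<Rightarrow> ('m, 'e::euclidean_space) chart set
    \<Rightarrow> ('m, 'e) conn \<Rightarrow> ('n \<Rightarrow> 'm) \<Rightarrow> 'n \<Rightarrow> 'd \<Rightarrow> ('n \<Rightarrow> 'e) \<Rightarrow> 'e" where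
  "cov_along B A D g n X Y =
     (let c = chart_at A (g n) in
        dir_deriv B n X (\<lambda>k. tcoord A c (g k) (Y k)) +
        (\<Sum>b\<in>Basis. (Y n \<bullet> b) *\<^sub>R D (g n) (mderiv B A g n X) (\<lambda>q. tvec A c q b)))"

section \<open>Hermitian surfaces\<close>

text \<open>Complex structure of the tangent spaces. Since the transition maps have complex linear
  derivatives, it is multiplication by \<open>\<i>\<close> in the coordinates of any chart.\<close>

definition J :: "complex ^ 2 \<Rightarrow> complex ^ 2" where
  "J v = \<i> *s v"

text \<open>A smooth map with complex linear derivatives is the same as a holomorphic map.\<close>

definition complex_surface :: "('m, complex ^ 2) chart set \<Rightarrow> bool" where
  "complex_surface A \<longleftrightarrow> smooth_atlas A \<and>
     Hausdorff_space (atlas_topology A) \<and> second_countable (atlas_topology A) \<and>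
     (\<forall>c\<in>A. \<forall>d\<in>A. \<forall>x \<in> map_ch c ` (dom_ch c \<inter> dom_ch d). \<forall>v.
        frechet_derivative (map_ch d \<circ> inv_ch c) (at x) (J v) =
        J (frechet_derivative (map_ch d \<circ> inv_ch c) (at x) v))"

type_synonym 'm metric = "'m \<Rightarrow> complex ^ 2 \<Rightarrow> complex ^ 2 \<Rightarrow> real"

definition hermitian_metric :: "('m, complex ^ 2) chart set \<Rightarrow> 'm metric \<Rightarrow> bool" where
  "hermitian_metric A h \<longleftrightarrow>
     (\<forall>p\<in>carrier_of A.
        bilinear (h p) \<and> (\<forall>X Y. h p X Y = h p Y X) \<and> (\<forall>X. X \<noteq> 0 \<longrightarrow> h p X X > 0) \<and>
        (\<forall>X Y. h p (J X) (J Y) = h p X Y)) \<and>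
     (\<forall>c\<in>A. \<forall>v w. smooth_fun A (dom_ch c) (\<lambda>p. h p (tvec A c p v) (tvec A c p w)))"

definition hermitian_surface :: "('m, complex ^ 2) chart set \<Rightarrow> 'm metric \<Rightarrow> bool" where
  "hermitian_surface A h \<longleftrightarrow> complex_surface A \<and> hermitian_metric A h"

definition hermitian_connection ::
  "('m, complex ^ 2) chart set \<Rightarrow> 'm metric \<Rightarrow> ('m, complex ^ 2) conn \<Rightarrow> bool" where
  "hermitian_connection A h D \<longleftrightarrow> connection A D \<and>
     (\<forall>W Y. openin (atlas_topology A) W \<and> smooth_vfield A W Y \<longrightarrow>
        (\<forall>p\<in>W. \<forall>X. D p X (\<lambda>q. J (Y q)) = J (D p X Y)) \<and>
        (\<forall>Y'. smooth_vfield A W Y' \<longrightarrow>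
           (\<forall>p\<in>W. \<forall>X. dir_deriv A p X (\<lambda>q. h q (Y q) (Y' q)) =
                        h p (D p X Y) (Y' p) + h p (Y p) (D p X Y'))))"

text \<open>The \<open>(1,1)\<close>-part of a vector valued 2-form \<open>T\<close> is \<open>(T(X,Y) + T(JX,JY))/2\<close>.\<close>

definition torsion11 :: "('m, complex ^ 2) chart set \<Rightarrow> ('m, complex ^ 2) conn
    \<Rightarrow> ('m \<Rightarrow> complex ^ 2) \<Rightarrow> ('m \<Rightarrow> complex ^ 2) \<Rightarrow> 'm \<Rightarrow> complex ^ 2" where
  "torsion11 A D X Y p =
     (1/2) *\<^sub>R (torsion A D X Y p + torsion A D (\<lambda>q. J (X q)) (\<lambda>q. J (Y q)) p)"

definition chern_connection ::
  "('m, complex ^ 2) chart set \<Rightarrow> 'm metric \<Rightarrow> ('m, complex ^ 2) conn \<Rightarrow> bool" where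
  "chern_connection A h D \<longleftrightarrow> hermitian_connection A h D \<and>
     (\<forall>W X Y. openin (atlas_topology A) W \<and> smooth_vfield A W X \<and> smooth_vfield A W Y \<longrightarrow>
        (\<forall>p\<in>W. torsion11 A D X Y p = 0))"

section \<open>Complexified tangent spaces and unitary frames\<close>

text \<open>The pair \<open>(a, b)\<close> stands for \<open>a + \<surd>-1 b\<close> in \<open>T\<^sub>p M \<otimes> \<complex>\<close>, with \<open>a, b\<close> real tangent vectors;
  \<open>\<surd>-1\<close> must not be confused with \<open>J\<close>.\<close>

type_synonym ctan = "(complex ^ 2) \<times> (complex ^ 2)"

definition cscale :: "complex \<Rightarrow> ctan \<Rightarrow> ctan" where
  "cscale t w = (Re t *\<^sub>R fst w - Im t *\<^sub>R snd w, Re t *\<^sub>R snd w + Im t *\<^sub>R fst w)"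

definition cconj :: "ctan \<Rightarrow> ctan" where
  "cconj w = (fst w, - snd w)"

definition T10 :: "ctan set" where
  "T10 = {w. (J (fst w), J (snd w)) = cscale \<i> w}"

definition cline :: "ctan \<Rightarrow> ctan set" where
  "cline w = range (\<lambda>t. cscale t w)"

text \<open>The fibre over \<open>p\<close> of the bundle \<open>Q\<close> of unitary frames.\<close>

definition unitary_frames :: "'m metric \<Rightarrow> 'm \<Rightarrow> (ctan \<times> ctan) set" where
  "unitary_frames h p =
     {(cscale (1 / sqrt 2) (e1, - e2), cscale (1 / sqrt 2) (e3, - e4)) | e1 e2 e3 e4.
        e2 = J e1 \<and> e4 = J e3 \<and>
        (\<forall>i<4. \<forall>j<4. h p ([e1, e2, e3, e4] ! i) ([e1, e2, e3, e4] ! j) = (if i = j then 1 else 0))}"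

section \<open>The twistor space\<close>

type_synonym 'm tpoint = "'m \<times> ctan set"

definition twistor_space :: "('m, complex ^ 2) chart set \<Rightarrow> 'm tpoint set" where
  "twistor_space A = {(p, cline w) | p w. p \<in> carrier_of A \<and> w \<in> T10 \<and> w \<noteq> 0}"

text \<open>Complex linear extension to \<open>T\<^sub>p M \<otimes> \<complex>\<close> of the differential of the \<open>j\<close>-th complex coordinate.\<close>

definition dz :: "('m, complex ^ 2) chart set \<Rightarrow> ('m, complex ^ 2) chart \<Rightarrow> 'm \<Rightarrow> 2 \<Rightarrow> ctan \<Rightarrow> complex" where
  "dz A c p j w = tcoord A c p (fst w) $ j + \<i> * tcoord A c p (snd w) $ j"

text \<open>Charts of the projectivised bundle: where \<open>dz\<^sup>j \<noteq> 0\<close>, the fibre coordinate is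
  \<open>dz\<^sup>k/dz\<^sup>j\<close> with \<open>{j, k} = {1, 2}\<close>.\<close>

definition twistor_chart :: "('m, complex ^ 2) chart set \<Rightarrow> ('m, complex ^ 2) chart \<Rightarrow> 2 \<Rightarrow> 2
    \<Rightarrow> ('m tpoint, (complex ^ 2) \<times> complex) chart" where
  "twistor_chart A c j k =
     ({(p, l) \<in> twistor_space A. p \<in> dom_ch c \<and> (\<exists>w\<in>l. dz A c p j w \<noteq> 0)},
      (\<lambda>(p, l). (map_ch c p, THE t. \<forall>w\<in>l. dz A c p k w = t * dz A c p j w)))"

definition twistor_atlas ::
  "('m, complex ^ 2) chart set \<Rightarrow> ('m tpoint, (complex ^ 2) \<times> complex) chart set" where
  "twistor_atlas A = {twistor_chart A c j k | c j k. c \<in> A \<and> j \<noteq> k}"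

text \<open>Smooth local sections \<open>u = (u\<^sub>1, u\<^sub>2)\<close> of \<open>\<pi>\<^sub>1 : Q \<rightarrow> Z\<close> over an open set \<open>W\<close>.\<close>

definition local_section :: "('m, complex ^ 2) chart set \<Rightarrow> 'm metric \<Rightarrow> 'm tpoint set
    \<Rightarrow> ('m tpoint \<Rightarrow> ctan \<times> ctan) \<Rightarrow> bool" where
  "local_section A h W u \<longleftrightarrow>
     openin (atlas_topology (twistor_atlas A)) W \<and>
     (\<forall>z\<in>W. u z \<in> unitary_frames h (fst z) \<and> cline (fst (u z)) = snd z) \<and>
     (\<forall>s \<in> {fst \<circ> fst, snd \<circ> fst, fst \<circ> snd, snd \<circ> snd}.
        smooth_along (twistor_atlas A) A fst W (\<lambda>z. s (u z)))"

section \<open>The forms on the twistor space and the almost complex structures\<close>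

text \<open>Tangent vectors of the twistor space are elements \<open>X\<close> of \<open>(complex ^ 2) \<times> complex\<close>.
  Below, \<open>u\<close> is a local section of \<open>\<pi>\<^sub>1 : Q \<rightarrow> Z\<close> near \<open>z\<close>. Since the composition of \<open>u\<close> with
  \<open>Q \<rightarrow> M\<close> is the projection \<open>fst : Z \<rightarrow> M\<close>, the definition of the canonical form \<open>(\<phi>\<^sup>1, \<phi>\<^sup>2)\<close>
  evaluated on \<open>u\<^sub>* X\<close> becomes the following one for \<open>u\<^sup>*(\<phi>\<^sup>1, \<phi>\<^sup>2)\<close>.\<close>

definition phi12 :: "('m, complex ^ 2) chart set \<Rightarrow> ('m tpoint \<Rightarrow> ctan \<times> ctan) \<Rightarrow> 'm tpoint
    \<Rightarrow> (complex ^ 2) \<times> complex \<Rightarrow> complex \<times> complex" where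
  "phi12 A u z X = (THE (t1, t2).
     (mderiv (twistor_atlas A) A fst z X, 0) =
       cscale t1 (fst (u z)) + cscale t2 (snd (u z)) +
       (cscale (cnj t1) (cconj (fst (u z))) + cscale (cnj t2) (cconj (snd (u z)))))"

definition phi1 where "phi1 A u z X = fst (phi12 A u z X)"
definition phi2 where "phi2 A u z X = snd (phi12 A u z X)"

text \<open>Complex linear extension of the pull-back of \<open>D\<close> by the projection \<open>Z \<rightarrow> M\<close>.\<close>

definition ccov :: "('m, complex ^ 2) chart set \<Rightarrow> ('m, complex ^ 2) conn \<Rightarrow> 'm tpoint
    \<Rightarrow> (complex ^ 2) \<times> complex \<Rightarrow> ('m tpoint \<Rightarrow> ctan) \<Rightarrow> ctan" where
  "ccov A D z X w =
     (cov_along (twistor_atlas A) A D fst z X (\<lambda>y. fst (w y)),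
      cov_along (twistor_atlas A) A D fst z X (\<lambda>y. snd (w y)))"

text \<open>The connection form of \<open>D\<close> on \<open>Q\<close>, pulled back by \<open>u\<close>, is the matrix of the pulled back
  connection in the frame \<open>u\<close>: \<open>D\<^sub>X u\<^sub>2 = \<psi>\<^sup>1\<^sub>2(X) u\<^sub>1 + \<psi>\<^sup>2\<^sub>2(X) u\<^sub>2\<close>, and \<open>\<phi>\<^sup>3 = \<psi>\<^sup>1\<^sub>2\<close>.\<close>

definition phi3 :: "('m, complex ^ 2) chart set \<Rightarrow> ('m, complex ^ 2) conn
    \<Rightarrow> ('m tpoint \<Rightarrow> ctan \<times> ctan) \<Rightarrow> 'm tpoint \<Rightarrow> (complex ^ 2) \<times> complex \<Rightarrow> complex" where
  "phi3 A D u z X = fst (THE (psi12, psi22).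
     ccov A D z X (\<lambda>y. snd (u y)) = cscale psi12 (fst (u z)) + cscale psi22 (snd (u z)))"

definition basis10 :: "nat \<Rightarrow> ('m, complex ^ 2) chart set \<Rightarrow> ('m, complex ^ 2) conn
    \<Rightarrow> ('m tpoint \<Rightarrow> ctan \<times> ctan) \<Rightarrow> 'm tpoint \<Rightarrow> ((complex ^ 2) \<times> complex \<Rightarrow> complex) set" where
  "basis10 i A D u z =
     (if i = 1 then {phi1 A u z, cnj \<circ> phi2 A u z, phi3 A D u z}
      else if i = 2 then {phi1 A u z, cnj \<circ> phi2 A u z, cnj \<circ> phi3 A D u z}
      else if i = 3 then {phi1 A u z, phi2 A u z, phi3 A D u z}
      else {phi1 A u z, phi2 A u z, cnj \<circ> phi3 A D u z})"

text \<open>The almost complex structure at \<open>z\<close> with the given \<open>(1,0)\<close>-forms: these are the forms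
  \<open>\<alpha>\<close> with \<open>\<alpha> \<circ> \<J> = \<i> \<alpha>\<close>. The metric \<open>h\<close> enters through the unitary frames, \<open>D\<close> is its
  Chern connection.\<close>

definition twistor_acs :: "nat \<Rightarrow> ('m, complex ^ 2) chart set \<Rightarrow> 'm metric \<Rightarrow> ('m, complex ^ 2) conn
    \<Rightarrow> 'm tpoint \<Rightarrow> (complex ^ 2) \<times> complex \<Rightarrow> (complex ^ 2) \<times> complex" where
  "twistor_acs i A h D z X = (THE Y. \<forall>W u. z \<in> W \<and> local_section A h W u \<longrightarrow>
     (\<forall>\<alpha>\<in>basis10 i A D u z. \<alpha> Y = \<i> * \<alpha> X))"

end

theory Submission
  imports Defs
begin

text \<open>On the fields with constant coordinates in a chart one has
  \<open>D'\<^sub>X Y = D\<^sub>X Y + df(X) Y - df(JX) JY\<close>, since the difference of the two sides is skew, commutes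
  with \<open>J\<close> and has no \<open>(1,1)\<close>-torsion, and such tensors vanish. On \<open>T\<^sup>1\<^sup>0\<close> the correction is scalar.
  If \<open>u\<close> is a local section of the unitary frames of \<open>h\<close>, then \<open>e\<^sup>-\<^sup>f u\<close> is one for \<open>e\<^sup>2\<^sup>f h\<close>, and
  passing to it multiplies \<open>\<phi>\<^sup>1, \<phi>\<^sup>2\<close> by \<open>e\<^sup>f\<close> and leaves \<open>\<phi>\<^sup>3\<close> unchanged: a scalar correction only
  affects the diagonal coefficient \<open>\<psi>\<^sup>2\<^sub>2\<close>. Hence the spans of the \<open>(1,0)\<close>-forms agree, and so do the
  conditions that define the almost complex structures.\<close>

section \<open>Iterated differentiability\<close>

text \<open>\<open>frechet_derivative\<close> chooses among all derivatives at the point, and maps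
  that agree near the point have the same derivatives. Where there is none, both sides are the same
  arbitrary value.\<close>

lemma frechet_derivative_cong_open:
  assumes "open S" "x \<in> S" "\<And>y. y \<in> S \<Longrightarrow> f y = g y"
  shows "frechet_derivative f (at x) = frechet_derivative g (at x)"
proof -
  have "(f has_derivative F) (at x) \<longleftrightarrow> (g has_derivative F) (at x)" for F
    using has_derivative_transform_within_open[of f F x UNIV S g]
      has_derivative_transform_within_open[of g F x UNIV S f] assms by auto
  then show ?thesis by (simp add: frechet_derivative_def)
qed

lemma Ck_on_cong:
  assumes "open S" "\<And>x. x \<in> S \<Longrightarrow> f x = g x"
  shows "Ck_on k S f \<longleftrightarrow> Ck_on k S g"
  using assms(2)
proof (induction k arbitrary: f g)
  case 0
  then show ?case using continuous_on_cong[OF refl, of S f g] by simp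
next
  case (Suc k)
  have "frechet_derivative f (at x) = frechet_derivative g (at x)" if "x \<in> S" for x
    by (rule frechet_derivative_cong_open[OF assms(1) that]) (rule Suc.prems)
  then have "Ck_on k S (\<lambda>x. frechet_derivative f (at x) v) \<longleftrightarrow>
      Ck_on k S (\<lambda>x. frechet_derivative g (at x) v)" for v
    by (intro Suc.IH) simp
  moreover have "f differentiable_on S \<longleftrightarrow> g differentiable_on S"
    by (metis differentiable_on_def differentiable_transform_within Suc.prems zero_less_one)
  ultimately show ?case by simp
qed

text \<open>\<open>Ck_on\<close> is phrased with the chosen \<open>frechet_derivative\<close>.
  Uniqueness of derivatives lets an explicit formula replace it, so the closure properties below can
  use the usual differentiation rules.\<close>

lemma Ck_on_SucI:
  assumes "open S" "\<And>x. x \<in> S \<Longrightarrow> (f has_derivative f' x) (at x)"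
    and "\<And>v. Ck_on k S (\<lambda>x. f' x v)"
  shows "Ck_on (Suc k) S f"
proof -
  have "Ck_on k S (\<lambda>x. frechet_derivative f (at x) v)" for v
    using Ck_on_cong[OF assms(1), of "\<lambda>x. frechet_derivative f (at x) v" "\<lambda>x. f' x v"] assms(3)
    by (simp add: frechet_derivative_at[OF assms(2), symmetric])
  moreover have "f differentiable_on S"
    using assms(1,2) differentiable_at_imp_differentiable_on differentiable_def by blast
  ultimately show ?thesis by simp
qed

lemma Ck_on_has_derivative:
  assumes "open S" "Ck_on (Suc k) S f" "x \<in> S"
  shows "(f has_derivative frechet_derivative f (at x)) (at x)"
  using assms differentiable_on_eq_differentiable_at[OF assms(1), of f]
  by (simp add: frechet_derivative_works)

text \<open>The product and chain rules leave undifferentiated factors behind, whose regularity must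
  be known to the lower order too.\<close>

lemma Ck_on_SucD:
  assumes "open S" "Ck_on (Suc k) S f"
  shows "Ck_on k S f"
  using assms(2)
proof (induction k arbitrary: f)
  case 0
  then show ?case using differentiable_imp_continuous_on by auto
next
  case (Suc k)
  from Suc.prems have "f differentiable_on S"
    and "Ck_on (Suc k) S (\<lambda>x. frechet_derivative f (at x) v)" for v
    by simp_all
  then show ?case using Suc.IH by simp
qed

lemma Ck_on_subset:
  assumes "Ck_on k S f" "T \<subseteq> S"
  shows "Ck_on k T f"
  using assms(1)
proof (induction k arbitrary: f)
  case 0
  then show ?case using assms(2) continuous_on_subset by auto
next
  case (Suc k)
  then show ?case using assms(2) differentiable_on_subset by auto
qed

lemma Ck_on_const: "open S \<Longrightarrow> Ck_on k S (\<lambda>x. c)"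
proof (induction k arbitrary: c)
  case (Suc k)
  show ?case by (rule Ck_on_SucI[where f' = "\<lambda>x v. 0"]) (use Suc in auto)
qed simp

lemma Ck_on_add:
  assumes "open S" "Ck_on k S f" "Ck_on k S g"
  shows "Ck_on k S (\<lambda>x. f x + g x)"
  using assms(2,3)
proof (induction k arbitrary: f g)
  case 0
  then show ?case by (simp add: continuous_on_add)
next
  case (Suc k)
  note d = Ck_on_has_derivative[OF assms(1) Suc.prems(1)]
    Ck_on_has_derivative[OF assms(1) Suc.prems(2)]
  show ?case
    by (rule Ck_on_SucI[OF assms(1) has_derivative_add[OF d]]) (use Suc in simp_all)
qed

lemma Ck_on_sum:
  assumes "open S" "\<And>i. i \<in> I \<Longrightarrow> Ck_on k S (f i)"
  shows "Ck_on k S (\<lambda>x. \<Sum>i\<in>I. f i x)"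
  using assms(2)
  by (induction I rule: infinite_finite_induct)
    (simp_all add: Ck_on_add Ck_on_const assms(1))

lemma Ck_on_bounded_linear:
  assumes "bounded_linear L" "open S" "Ck_on k S f"
  shows "Ck_on k S (\<lambda>x. L (f x))"
  using assms(3)
proof (induction k arbitrary: f)
  case 0
  then show ?case by (simp add: bounded_linear.continuous_on[OF assms(1)])
next
  case (Suc k)
  note d = Ck_on_has_derivative[OF assms(2) Suc.prems]
  show ?case
    by (rule Ck_on_SucI[OF assms(2) bounded_linear.has_derivative[OF assms(1) d]])
      (use Suc in simp_all)
qed

lemma Ck_on_bilinear:
  assumes "bounded_bilinear m" "open S" "Ck_on k S f" "Ck_on k S g"
  shows "Ck_on k S (\<lambda>x. m (f x) (g x))"
  using assms(3,4)
proof (induction k arbitrary: f g)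
  case 0
  then show ?case by (simp add: bounded_bilinear.continuous_on[OF assms(1)])
next
  case (Suc k)
  note d = Ck_on_has_derivative[OF assms(2) Suc.prems(1)]
    Ck_on_has_derivative[OF assms(2) Suc.prems(2)]
  show ?case
  proof (rule Ck_on_SucI[OF assms(2) bounded_bilinear.FDERIV[OF assms(1) d]])
    show "Ck_on k S (\<lambda>x. m (f x) (frechet_derivative g (at x) v) +
        m (frechet_derivative f (at x) v) (g x))" for v
      using Ck_on_SucD[OF assms(2) Suc.prems(1)] Ck_on_SucD[OF assms(2) Suc.prems(2)] Suc.prems
      by (intro Ck_on_add[OF assms(2)] Suc.IH) simp_all
  qed
qed

lemma Ck_on_linear_map:
  assumes "bounded_linear L" "open S"
  shows "Ck_on k S L"
proof (cases k)
  case 0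
  then show ?thesis by (simp add: assms(1) linear_continuous_on)
next
  case (Suc j)
  show ?thesis unfolding Suc
    by (rule Ck_on_SucI[OF assms(2) bounded_linear_imp_has_derivative[OF assms(1)]])
      (simp add: Ck_on_const assms(2))
qed

lemma Ck_on_compose:
  fixes \<phi> :: "'a::real_normed_vector \<Rightarrow> 'b::euclidean_space"
  assumes "open S" "open T" "\<phi> ` S \<subseteq> T" "Ck_on k T g" "Ck_on k S \<phi>"
  shows "Ck_on k S (\<lambda>x. g (\<phi> x))"
  using assms(4,5)
proof (induction k arbitrary: g)
  case 0
  then show ?case using assms(3) continuous_on_compose2 by auto
next
  case (Suc k)
  let ?D = "\<lambda>x v. frechet_derivative g (at (\<phi> x)) (frechet_derivative \<phi> (at x) v)"
  have d\<phi>: "(\<phi> has_derivative frechet_derivative \<phi> (at x)) (at x)" if "x \<in> S" for x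
    using Ck_on_has_derivative[OF assms(1) Suc.prems(2) that] .
  have dg: "(g has_derivative frechet_derivative g (at (\<phi> x))) (at (\<phi> x))" if "x \<in> S" for x
    using Ck_on_has_derivative[OF assms(2) Suc.prems(1)] that assms(3) by blast
  have "((\<lambda>x. g (\<phi> x)) has_derivative ?D x) (at x)" if "x \<in> S" for x
    using diff_chain_at[OF d\<phi>[OF that] dg[OF that]] by (simp add: o_def)
  moreover have "Ck_on k S (\<lambda>x. ?D x v)" for v
  proof -
    \<comment> \<open>\<open>Ck_on\<close> controls derivatives of \<open>g\<close> in a fixed
      direction, but here the direction moves with \<open>x\<close>. Expanding it in the basis
      separates moving coefficients from derivatives in the fixed directions
      \<open>b\<close>.\<close>
    have "?D x v = (\<Sum>b\<in>Basis. (frechet_derivative \<phi> (at x) v \<bullet> b) *\<^sub>R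
        frechet_derivative g (at (\<phi> x)) b)" if "x \<in> S" for x
      using has_derivative_linear[OF dg[OF that]]
      by (subst (1) euclidean_representation[symmetric, of "frechet_derivative \<phi> (at x) v"])
        (simp only: linear_sum linear_cmul)
    moreover have "Ck_on k S (\<lambda>x. \<Sum>b\<in>Basis. (frechet_derivative \<phi> (at x) v \<bullet> b) *\<^sub>R
        frechet_derivative g (at (\<phi> x)) b)"
    proof (intro Ck_on_sum[OF assms(1)] Ck_on_bilinear[OF bounded_bilinear_scaleR assms(1)]
          Ck_on_bounded_linear[OF bounded_linear_inner_left assms(1)])
      show "Ck_on k S (\<lambda>x. frechet_derivative \<phi> (at x) v)"
        using Suc.prems(2) by simp
      show "Ck_on k S (\<lambda>x. frechet_derivative g (at (\<phi> x)) b)" for b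
        by (rule Suc.IH) (use Suc.prems Ck_on_SucD[OF assms(1) Suc.prems(2)] in simp_all)
    qed
    ultimately show ?thesis
      by (subst Ck_on_cong[OF assms(1)])
  qed
  ultimately show ?case by (rule Ck_on_SucI[OF assms(1)])
qed

text \<open>The derivative reproduces \<open>exp (f x)\<close> with the same \<open>f\<close> as a
  factor, so the induction keeps \<open>f\<close> fixed and lowers only the order.\<close>

lemma Ck_on_exp:
  fixes f :: "'a::real_normed_vector \<Rightarrow> real"
  assumes "open S" "Ck_on k S f"
  shows "Ck_on k S (\<lambda>x. exp (f x))"
  using assms(2)
proof (induction k)
  case 0
  then show ?case by (simp add: continuous_on_exp)
next
  case (Suc k)
  have "((\<lambda>x. exp (f x)) has_derivative (\<lambda>v. exp (f x) * frechet_derivative f (at x) v)) (at x)"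
    if "x \<in> S" for x
    using Ck_on_has_derivative[OF assms(1) Suc.prems that]
    by (auto intro!: derivative_eq_intros)
  moreover have "Ck_on k S (\<lambda>x. exp (f x) * frechet_derivative f (at x) v)" for v
    using Suc.IH[OF Ck_on_SucD[OF assms(1) Suc.prems]] Suc.prems
    by (intro Ck_on_bilinear[OF bounded_bilinear_mult assms(1)]) simp_all
  ultimately show ?case by (rule Ck_on_SucI[OF assms(1)])
qed

section \<open>Smooth maps on open sets\<close>

lemma smooth_on_has_derivative:
  assumes "open S" "smooth_on S f" "x \<in> S"
  shows "(f has_derivative frechet_derivative f (at x)) (at x)"
  using Ck_on_has_derivative[OF assms(1) _ assms(3), of 0] assms(2) unfolding smooth_on_def by blast

lemma smooth_on_subset: "smooth_on S f \<Longrightarrow> T \<subseteq> S \<Longrightarrow> smooth_on T f"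
  unfolding smooth_on_def using Ck_on_subset by blast

lemma smooth_on_cong:
  assumes "open S" "\<And>x. x \<in> S \<Longrightarrow> f x = g x"
  shows "smooth_on S f \<longleftrightarrow> smooth_on S g"
  using Ck_on_cong[of S f g, OF assms] unfolding smooth_on_def by blast

lemma smooth_on_compose:
  fixes \<phi> :: "'a::real_normed_vector \<Rightarrow> 'b::euclidean_space"
  assumes "open S" "open T" "\<phi> ` S \<subseteq> T" "smooth_on T g" "smooth_on S \<phi>"
  shows "smooth_on S (\<lambda>x. g (\<phi> x))"
  using Ck_on_compose[OF assms(1-3)] assms(4,5) unfolding smooth_on_def by blast

lemma smooth_on_frechet_derivative:
  assumes "smooth_on S f"
  shows "smooth_on S (\<lambda>x. frechet_derivative f (at x) v)"
  unfolding smooth_on_def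
proof
  fix k
  have "Ck_on (Suc k) S f" using assms unfolding smooth_on_def ..
  then show "Ck_on k S (\<lambda>x. frechet_derivative f (at x) v)" by simp
qed

section \<open>Charts and coordinate vector fields\<close>

text \<open>Injective charts map intersections to intersections, which makes the defining predicate
  a topology. Assuming just injectivity lets the lemma serve the twistor atlas as well, through
  \<open>twistor_atlas_inj\<close>.\<close>

lemma openin_atlas_topology:
  fixes A :: "('m, 'e::euclidean_space) chart set"
  assumes inj: "\<And>c. c \<in> A \<Longrightarrow> inj_on (map_ch c) (dom_ch c)"
  shows "openin (atlas_topology A) W \<longleftrightarrow>
    W \<subseteq> carrier_of A \<and> (\<forall>c\<in>A. open (map_ch c ` (W \<inter> dom_ch c)))"
proof -
  let ?L = "\<lambda>W. W \<subseteq> carrier_of A \<and> (\<forall>c\<in>A. open (map_ch c ` (W \<inter> dom_ch c)))"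
  have "istopology ?L"
    unfolding istopology_def
  proof (intro conjI allI impI)
    fix S T assume "?L S" "?L T"
    moreover have "map_ch c ` (S \<inter> T \<inter> dom_ch c) =
        map_ch c ` (S \<inter> dom_ch c) \<inter> map_ch c ` (T \<inter> dom_ch c)" if "c \<in> A" for c
      using inj[OF that] by (auto simp: inj_on_def)
    ultimately show "S \<inter> T \<subseteq> carrier_of A"
      and "\<forall>c\<in>A. open (map_ch c ` (S \<inter> T \<inter> dom_ch c))" by auto
  next
    fix K assume K: "\<forall>S\<in>K. ?L S"
    show "\<Union>K \<subseteq> carrier_of A" using K by auto
    show "\<forall>c\<in>A. open (map_ch c ` (\<Union>K \<inter> dom_ch c))"
    proof
      fix c assume "c \<in> A"
      have "map_ch c ` (\<Union>K \<inter> dom_ch c) = (\<Union>S\<in>K. map_ch c ` (S \<inter> dom_ch c))" by auto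
      then show "open (map_ch c ` (\<Union>K \<inter> dom_ch c))" using K \<open>c \<in> A\<close> by auto
    qed
  qed
  then show ?thesis unfolding atlas_topology_def by (simp add: topology_inverse')
qed

lemma chart_at:
  assumes "p \<in> carrier_of A"
  shows "chart_at A p \<in> A" "p \<in> dom_ch (chart_at A p)"
proof -
  have "\<exists>c. c \<in> A \<and> p \<in> dom_ch c" using assms by (auto simp: carrier_of_def)
  then have "chart_at A p \<in> A \<and> p \<in> dom_ch (chart_at A p)"
    unfolding chart_at_def by (rule someI_ex)
  then show "chart_at A p \<in> A" "p \<in> dom_ch (chart_at A p)" by auto
qed

lemma carrier_ofI: "c \<in> A \<Longrightarrow> p \<in> dom_ch c \<Longrightarrow> p \<in> carrier_of A"
  by (auto simp: carrier_of_def)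

section \<open>Change of coordinates for tangent vectors\<close>

abbreviation (input) trans_deriv where
  "trans_deriv c d p \<equiv> frechet_derivative (map_ch d \<circ> inv_ch c) (at (map_ch c p))"

lemma tcoord_eq: "tcoord A c p X = trans_deriv (chart_at A p) c p X"
  by (simp add: tcoord_def dir_deriv_def)

lemma tvec_eq: "tvec A c p v = trans_deriv c (chart_at A p) p v"
  by (simp add: tvec_def)

lemma smooth_fun_subset: "smooth_fun A W f \<Longrightarrow> V \<subseteq> W \<Longrightarrow> smooth_fun A V f"
  unfolding smooth_fun_def using smooth_on_subset by (metis Int_mono image_mono order_refl)

lemma inv_ch_map_ch: "inj_on (map_ch c) (dom_ch c) \<Longrightarrow> p \<in> dom_ch c \<Longrightarrow> inv_ch c (map_ch c p) = p"
  by (simp add: inv_ch_def the_inv_into_f_f)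

context
  fixes A :: "('m, 'e::euclidean_space) chart set"
  assumes A: "smooth_atlas A"
begin

lemma atlas_inj: "c \<in> A \<Longrightarrow> inj_on (map_ch c) (dom_ch c)"
  and atlas_open: "c \<in> A \<Longrightarrow> d \<in> A \<Longrightarrow> open (map_ch c ` (dom_ch c \<inter> dom_ch d))"
  and atlas_smooth: "c \<in> A \<Longrightarrow> d \<in> A \<Longrightarrow>
    smooth_on (map_ch c ` (dom_ch c \<inter> dom_ch d)) (map_ch d \<circ> inv_ch c)"
  and atlas_open_dom: "c \<in> A \<Longrightarrow> open (map_ch c ` dom_ch c)"
  using A unfolding smooth_atlas_def by auto

lemma atlas_inv: "c \<in> A \<Longrightarrow> p \<in> dom_ch c \<Longrightarrow> inv_ch c (map_ch c p) = p"
  by (rule inv_ch_map_ch[OF atlas_inj])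

lemma openin_dom: "c \<in> A \<Longrightarrow> openin (atlas_topology A) (dom_ch c)"
  using openin_atlas_topology[OF atlas_inj] atlas_open
  by (auto simp: carrier_of_def Int_commute)

lemma atlas_open3:
  assumes "c \<in> A" "d \<in> A" "e \<in> A"
  shows "open (map_ch c ` (dom_ch c \<inter> dom_ch d \<inter> dom_ch e))"
proof -
  have "map_ch c ` (dom_ch c \<inter> dom_ch d \<inter> dom_ch e) =
      map_ch c ` (dom_ch c \<inter> dom_ch d) \<inter> map_ch c ` (dom_ch c \<inter> dom_ch e)"
    using atlas_inj[OF assms(1)] by (auto simp: inj_on_def)
  then show ?thesis using atlas_open[OF assms(1,2)] atlas_open[OF assms(1,3)] by auto
qed

lemma trans_has_derivative:
  assumes "c \<in> A" "d \<in> A" "p \<in> dom_ch c" "p \<in> dom_ch d"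
  shows "((map_ch d \<circ> inv_ch c) has_derivative trans_deriv c d p) (at (map_ch c p))"
  by (rule smooth_on_has_derivative[OF atlas_open atlas_smooth]) (use assms in auto)

lemma trans_deriv_self:
  assumes "c \<in> A" "p \<in> dom_ch c"
  shows "trans_deriv c c p v = v"
proof -
  have "trans_deriv c c p = frechet_derivative (\<lambda>x. x) (at (map_ch c p))"
    by (rule frechet_derivative_cong_open[OF atlas_open_dom[OF assms(1)]])
      (use assms in \<open>auto simp: atlas_inv\<close>)
  then show ?thesis by simp
qed

text \<open>The cocycle rule is the chain rule: the composite coordinate change agrees with the
  direct one on the triple overlap, which is open by \<open>atlas_open3\<close>.\<close>

lemma trans_deriv_trans:
  assumes "c \<in> A" "d \<in> A" "e \<in> A" "p \<in> dom_ch c" "p \<in> dom_ch d" "p \<in> dom_ch e"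
  shows "trans_deriv d e p (trans_deriv c d p v) = trans_deriv c e p v"
proof -
  let ?g = "(map_ch e \<circ> inv_ch d) \<circ> (map_ch d \<circ> inv_ch c)"
  have *: "(map_ch d \<circ> inv_ch c) (map_ch c p) = map_ch d p"
    using atlas_inv assms by simp
  have "(?g has_derivative (trans_deriv d e p \<circ> trans_deriv c d p)) (at (map_ch c p))"
    by (rule diff_chain_at[OF trans_has_derivative]) (use trans_has_derivative assms * in auto)
  then have "trans_deriv d e p \<circ> trans_deriv c d p = frechet_derivative ?g (at (map_ch c p))"
    by (rule frechet_derivative_at)
  also have "\<dots> = trans_deriv c e p"
    by (rule frechet_derivative_cong_open[OF atlas_open3[of c d e]])
      (use assms in \<open>auto simp: atlas_inv\<close>)
  finally show ?thesis by (metis comp_apply)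
qed

lemma linear_trans_deriv:
  "c \<in> A \<Longrightarrow> d \<in> A \<Longrightarrow> p \<in> dom_ch c \<Longrightarrow> p \<in> dom_ch d \<Longrightarrow> linear (trans_deriv c d p)"
  by (rule has_derivative_linear[OF trans_has_derivative])

lemma linear_tcoord:
  assumes "c \<in> A" "p \<in> dom_ch c"
  shows "linear (tcoord A c p)"
  using linear_trans_deriv[of "chart_at A p" c p] chart_at[OF carrier_ofI[OF assms]] assms
  by (simp add: tcoord_eq[abs_def])

lemma tcoord_tvec:
  assumes "c \<in> A" "d \<in> A" "p \<in> dom_ch c" "p \<in> dom_ch d"
  shows "tcoord A d p (tvec A c p v) = trans_deriv c d p v"
  using trans_deriv_trans chart_at[OF carrier_ofI[OF assms(1,3)]] assms
  by (simp add: tcoord_eq tvec_eq)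

lemma tcoord_tvec_same: "c \<in> A \<Longrightarrow> p \<in> dom_ch c \<Longrightarrow> tcoord A c p (tvec A c p v) = v"
  by (simp add: tcoord_tvec trans_deriv_self)

lemma tvec_tcoord:
  assumes "c \<in> A" "p \<in> dom_ch c"
  shows "tvec A c p (tcoord A c p X) = X"
  using trans_deriv_trans trans_deriv_self chart_at[OF carrier_ofI[OF assms]] assms
  by (simp add: tcoord_eq tvec_eq)

lemma tcoord_chart_at: "p \<in> carrier_of A \<Longrightarrow> tcoord A (chart_at A p) p X = X"
  by (simp add: tcoord_eq trans_deriv_self chart_at)

lemma tvec_chart_at: "p \<in> carrier_of A \<Longrightarrow> tvec A (chart_at A p) p v = v"
  by (simp add: tvec_eq trans_deriv_self chart_at)

text \<open>In a chart \<open>d\<close> the field has as coordinates the derivative of the change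
  from \<open>c\<close> to \<open>d\<close> in the fixed direction \<open>v\<close>. Read in a third
  chart \<open>e\<close>, this is composed with the change from \<open>e\<close> to
  \<open>c\<close>, and both are smooth.\<close>

lemma smooth_vfield_tvec:
  assumes "c \<in> A"
  shows "smooth_vfield A (dom_ch c) (\<lambda>q. tvec A c q v)"
  unfolding smooth_vfield_def smooth_along_def smooth_fun_def
proof (intro ballI)
  fix d e assume de: "d \<in> A" "e \<in> A"
  let ?S = "map_ch e ` (dom_ch e \<inter> dom_ch c \<inter> dom_ch d)"
  have *: "dom_ch c \<inter> (\<lambda>p. p) -` dom_ch d \<inter> dom_ch e = dom_ch e \<inter> dom_ch c \<inter> dom_ch d" by auto
  have "smooth_on ?S (\<lambda>x. (\<lambda>y. frechet_derivative (map_ch d \<circ> inv_ch c) (at y) v)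
      ((map_ch c \<circ> inv_ch e) x))"
    using assms de
    by (intro smooth_on_compose[OF atlas_open3 atlas_open _
          smooth_on_frechet_derivative[OF atlas_smooth] smooth_on_subset[OF atlas_smooth]])
      (auto simp: atlas_inv)
  then show "smooth_on (map_ch e ` (dom_ch c \<inter> (\<lambda>p. p) -` dom_ch d \<inter> dom_ch e))
      ((\<lambda>n. tcoord A d n (tvec A c n v)) \<circ> inv_ch e)"
    unfolding *
    by (subst smooth_on_cong[OF atlas_open3]) (use assms de in \<open>auto simp: atlas_inv tcoord_tvec\<close>)
qed

text \<open>The bracket at \<open>p\<close> differentiates coordinates in
  \<open>chart_at A p\<close>, and these are constant. The hypotheses speak of coordinates rather
  than of \<open>tvec\<close> so that the lemma also covers fields obtained by applying
  \<open>J\<close>.\<close>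

lemma lie_bracket_const_coord:
  assumes p: "p \<in> carrier_of A"
    and X: "\<And>q. q \<in> dom_ch (chart_at A p) \<Longrightarrow> tcoord A (chart_at A p) q (X q) = v"
    and Y: "\<And>q. q \<in> dom_ch (chart_at A p) \<Longrightarrow> tcoord A (chart_at A p) q (Y q) = w"
  shows "lie_bracket A X Y p = 0"
proof -
  note c = chart_at[OF p]
  have "dir_deriv A p u (\<lambda>q. tcoord A (chart_at A p) q (Z q)) = 0"
    if "\<And>q. q \<in> dom_ch (chart_at A p) \<Longrightarrow> tcoord A (chart_at A p) q (Z q) = z" for u Z and z :: 'e
  proof -
    have "dir_deriv A p u (\<lambda>q. tcoord A (chart_at A p) q (Z q)) =
        frechet_derivative (\<lambda>x. z) (at (map_ch (chart_at A p) p)) u"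
      unfolding dir_deriv_def
      by (subst frechet_derivative_cong_open[OF atlas_open_dom[OF c(1)], where g = "\<lambda>x. z"])
        (use c that in \<open>auto simp: atlas_inv\<close>)
    then show ?thesis by simp
  qed
  from this[OF X] this[OF Y] show ?thesis unfolding lie_bracket_def by simp
qed

lemma smooth_fun_has_derivative:
  assumes "c \<in> A" "smooth_fun A W f" "p \<in> dom_ch c" "dom_ch c \<subseteq> W"
  shows "((f \<circ> inv_ch c) has_derivative frechet_derivative (f \<circ> inv_ch c) (at (map_ch c p)))
    (at (map_ch c p))"
proof -
  have "smooth_on (map_ch c ` dom_ch c) (f \<circ> inv_ch c)"
    using assms unfolding smooth_fun_def by (metis inf.absorb2)
  from smooth_on_has_derivative[OF atlas_open_dom this] assms show ?thesis by auto
qed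

end

section \<open>Chern connections of conformal metrics\<close>

lemma linear_J: "linear J"
  by (auto simp: J_def linear_iff vec_eq_iff algebra_simps scaleR_conv_of_real[where 'a=complex])

lemma J_J [simp]: "J (J v) = - v"
  by (simp add: J_def vec_eq_iff)

lemmas J_linear_simps = linear_add[OF linear_J] linear_diff[OF linear_J] linear_neg[OF linear_J]
  linear_cmul[OF linear_J] linear_0[OF linear_J]

lemma J_eq_iff [simp]: "J v = J w \<longleftrightarrow> v = w"
  by (metis J_J neg_equal_iff_equal)

lemma J_eq_0_iff [simp]: "J v = 0 \<longleftrightarrow> v = 0"
  by (metis J_eq_iff J_linear_simps(5))

lemma complex_surface_atlas: "complex_surface A \<Longrightarrow> smooth_atlas A"
  by (simp add: complex_surface_def)

lemma tvec_J:
  assumes "complex_surface A" "c \<in> A" "p \<in> dom_ch c"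
  shows "tvec A c p (J v) = J (tvec A c p v)"
  using assms chart_at[OF carrier_ofI[OF assms(2,3)]]
  unfolding complex_surface_def tvec_def by blast

lemma tcoord_J:
  assumes "complex_surface A" "c \<in> A" "p \<in> dom_ch c"
  shows "tcoord A c p (J v) = J (tcoord A c p v)"
  using assms chart_at[OF carrier_ofI[OF assms(2,3)]]
  unfolding complex_surface_def tcoord_def dir_deriv_def by blast

text \<open>A connection here acts on vector fields, so two connections are compared at
  \<open>p\<close> on these fields, whose value at \<open>p\<close> is \<open>v\<close> itself. They
  are also the fields that occur in \<open>cov_along\<close>.\<close>

definition coord_field :: "('m, 'e::euclidean_space) chart set \<Rightarrow> 'm \<Rightarrow> 'e \<Rightarrow> 'm \<Rightarrow> 'e" where
  "coord_field A p v q = tvec A (chart_at A p) q v"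

text \<open>Turns the Chern axioms, which quantify over smooth fields, into linear algebra at the
  single point \<open>p\<close>. The last claim is the vanishing of the \<open>(1,1)\<close>-torsion
  once the brackets are gone and \<open>J\<close> has been moved out of the derivatives.\<close>

lemma chern_connection_coord_field:
  assumes A: "complex_surface A" and D: "chern_connection A h D" and p: "p \<in> carrier_of A"
  defines "Y \<equiv> coord_field A p"
  shows "linear (\<lambda>X. D p X (Y v))"
    and "D p X (Y (J v)) = J (D p X (Y v))"
    and "dir_deriv A p X (\<lambda>q. h q (Y v q) (Y w q)) = h p (D p X (Y v)) w + h p v (D p X (Y w))"
    and "D p v (Y w) + J (D p (J v) (Y w)) = D p w (Y v) + J (D p (J w) (Y v))"
proof -
  let ?c = "chart_at A p" and ?W = "dom_ch (chart_at A p)"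
  note at = complex_surface_atlas[OF A]
  note c = chart_at[OF p]
  have W: "openin (atlas_topology A) ?W" by (rule openin_dom[OF at c(1)])
  have sm: "smooth_vfield A ?W (Y v)" for v
    using smooth_vfield_tvec[OF at c(1)] unfolding Y_def coord_field_def[abs_def] .
  have Yp: "Y v p = v" for v unfolding Y_def coord_field_def by (rule tvec_chart_at[OF at p])
  have JY: "J (Y v q) = Y (J v) q" if "q \<in> ?W" for v q
    unfolding Y_def coord_field_def by (simp add: tvec_J[OF A c(1) that])
  have con: "connection A D" and herm: "hermitian_connection A h D"
    using D unfolding chern_connection_def hermitian_connection_def by auto
  note con = con[unfolded connection_def, rule_format, OF conjI, OF W sm]
  note herm = herm[unfolded hermitian_connection_def, THEN conjunct2, rule_format, OF conjI, OF W sm]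
  show "linear (\<lambda>X. D p X (Y v))" using con c(2) by blast
  have DJ: "D p X (\<lambda>q. J (Y v q)) = J (D p X (Y v))" for X v using herm c(2) by blast
  \<comment> \<open>The two fields are known to agree on the chart domain, so this is the locality
    clause of \<open>connection\<close>.\<close>
  have "D p X (\<lambda>q. J (Y v q)) = D p X (Y (J v))"
    by (rule con[of "J v", THEN conjunct2, THEN conjunct2, THEN conjunct2, THEN conjunct1,
          rule_format, OF _ c(2)]) (rule JY)
  with DJ show "D p X (Y (J v)) = J (D p X (Y v))" by simp
  show "dir_deriv A p X (\<lambda>q. h q (Y v q) (Y w q)) = h p (D p X (Y v)) w + h p v (D p X (Y w))"
    using herm[of v] sm[of w] c(2) by (simp add: Yp)
  have tY: "tcoord A ?c q (Y v q) = v" if "q \<in> ?W" for v q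
    unfolding Y_def coord_field_def by (rule tcoord_tvec_same[OF at c(1) that])
  \<comment> \<open>On the chart domain the rotated fields have the constant coordinates
    \<open>J v\<close> and \<open>J w\<close>, so both brackets vanish.\<close>
  have br: "lie_bracket A (Y v) (Y w) p = 0"
    "lie_bracket A (\<lambda>q. J (Y v q)) (\<lambda>q. J (Y w q)) p = 0"
    by (rule lie_bracket_const_coord[OF at p], simp_all add: JY tY)+
  have "torsion11 A D (Y v) (Y w) p = 0"
    using D sm W c(2) unfolding chern_connection_def by blast
  then have "D p v (Y w) - D p w (Y v) + (J (D p (J v) (Y w)) - J (D p (J w) (Y v))) = 0"
    unfolding torsion11_def torsion_def br by (simp add: Yp DJ)
  then show "D p v (Y w) + J (D p (J v) (Y w)) = D p w (Y v) + J (D p (J w) (Y v))"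
    by (subst eq_iff_diff_eq_0) (simp add: algebra_simps)
qed

text \<open>This is uniqueness of the Chern connection, stated for the difference tensor. The map
  \<open>B\<close> is complex linear in the second argument, antilinear in the first and symmetric
  by \<open>tor\<close>, hence zero; this says that \<open>S (J X) Y = J (S X Y)\<close>. So
  \<open>J\<close> composed with \<open>S X\<close> is skew, being \<open>S (J X)\<close>, but also
  symmetric, being a product of commuting skew maps. Positivity of \<open>g\<close> then makes it
  zero.\<close>

lemma skew_torsion_free_imp_zero:
  fixes S :: "complex ^ 2 \<Rightarrow> complex ^ 2 \<Rightarrow> complex ^ 2"
  assumes lin: "\<And>v. linear (\<lambda>X. S X v)"
    and SJ: "\<And>X v. S X (J v) = J (S X v)"
    and tor: "\<And>v w. S v w + J (S (J v) w) = S w v + J (S (J w) v)"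
    and g: "bilinear g" "\<And>X. X \<noteq> 0 \<Longrightarrow> g X X > 0" "\<And>X Y. g (J X) (J Y) = g X Y"
    and skew: "\<And>X v w. g (S X v) w + g v (S X w) = (0::real)"
  shows "S X v = 0"
proof -
  define B where "B X Y = S X Y + J (S (J X) Y)" for X Y
  have sym: "B X Y = B Y X" for X Y unfolding B_def by (rule tor)
  have B1: "B X (J Y) = J (B X Y)" for X Y
    by (simp add: B_def SJ J_linear_simps)
  have B2: "B (J X) Y = - J (B X Y)" for X Y
    using linear_neg[OF lin, of X Y] by (simp add: B_def J_linear_simps)
  have "J (B X Y) = - J (B X Y)" for X Y
    by (metis B1 B2 sym)
  then have "2 *\<^sub>R J (B X Y) = 0" for X Y by (metis scaleR_2 add.right_inverse)
  then have "B X Y = 0" for X Y by simp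
  then have "J (B X Y) = 0" for X Y by (simp add: J_linear_simps)
  then have JS: "J (S X Y) = S (J X) Y" for X Y
    by (simp add: B_def J_linear_simps)
  have g_neg: "g v (- w) = - g v w" "g (- v) w = - g v w" for v w
    using bilinear_rneg[OF g(1)] bilinear_lneg[OF g(1)] by auto
  have "g (J (S X v)) w = 0" for w
  proof -
    have "g (J (S X v)) w = - g v (J (S X w))" using skew[of "J X" v w] JS by simp
    also have "\<dots> = g (J v) (S X w)" using g(3)[of v "J (S X w)"] by (simp add: g_neg)
    also have "\<dots> = - g (J (S X v)) w" using skew[of X "J v" w] SJ by simp
    finally show ?thesis by simp
  qed
  then have "J (S X v) = 0" using g(2) by (metis less_irrefl)
  then show ?thesis by simp
qed

lemma dir_deriv_has_derivative:
  assumes "smooth_atlas A" "p \<in> carrier_of A" "smooth_fun A W f" "dom_ch (chart_at A p) \<subseteq> W"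
  shows "((f \<circ> inv_ch (chart_at A p)) has_derivative (\<lambda>X. dir_deriv A p X f))
    (at (map_ch (chart_at A p) p))"
  unfolding dir_deriv_def
  using smooth_fun_has_derivative[OF assms(1) chart_at(1)[OF assms(2)] assms(3)
      chart_at(2)[OF assms(2)] assms(4)] .

lemma dir_derivI:
  "((f \<circ> inv_ch (chart_at A p)) has_derivative F) (at (map_ch (chart_at A p) p)) \<Longrightarrow>
    dir_deriv A p X f = F X"
  unfolding dir_deriv_def by (metis frechet_derivative_at)

text \<open>In complex notation the correction term is \<open>2 \<partial>f(X) Y\<close>.\<close>

lemma chern_connection_conformal:
  assumes surf: "hermitian_surface A h" and f: "smooth_fun A (carrier_of A) f"
    and D: "chern_connection A h D"
    and D': "chern_connection A (\<lambda>p X Y. exp (2 * f p) * h p X Y) D'"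
    and p: "p \<in> carrier_of A"
  defines "Y \<equiv> coord_field A p"
  shows "D' p X (Y v) =
    D p X (Y v) + dir_deriv A p X f *\<^sub>R v - dir_deriv A p (J X) f *\<^sub>R J v"
proof -
  have A: "complex_surface A" and h: "hermitian_metric A h"
    using surf unfolding hermitian_surface_def by auto
  note at = complex_surface_atlas[OF A]
  let ?c = "chart_at A p"
  note c = chart_at[OF p]
  note d = chern_connection_coord_field[OF A D p, folded Y_def]
  note d' = chern_connection_coord_field[OF A D' p, folded Y_def]
  let ?f = "\<lambda>X. dir_deriv A p X f"
  have f': "((f \<circ> inv_ch ?c) has_derivative ?f) (at (map_ch ?c p))"
    using dir_deriv_has_derivative[OF at p f] c by (auto simp: carrier_of_def)
  have lin_f: "linear ?f" by (rule has_derivative_linear[OF f'])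
  have bil: "bilinear (h p)" and pos: "\<And>X. X \<noteq> 0 \<Longrightarrow> h p X X > 0"
    and hJ: "\<And>X Y. h p (J X) (J Y) = h p X Y"
    using h p unfolding hermitian_metric_def by blast+
  have Yp: "Y v p = v" for v unfolding Y_def coord_field_def by (rule tvec_chart_at[OF at p])
  have metric': "dir_deriv A p X (\<lambda>q. exp (2 * f q) * h q (Y v q) (Y w q)) =
      exp (2 * f p) * (2 * ?f X * h p v w + dir_deriv A p X (\<lambda>q. h q (Y v q) (Y w q)))"
    for X v w
  proof -
    let ?H = "\<lambda>q. h q (Y v q) (Y w q)"
    have "smooth_fun A (dom_ch ?c) ?H"
      using h c(1) unfolding hermitian_metric_def Y_def coord_field_def by blast
    then have H: "((?H \<circ> inv_ch ?c) has_derivative (\<lambda>X. dir_deriv A p X ?H)) (at (map_ch ?c p))"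
      by (rule dir_deriv_has_derivative[OF at p]) simp
    have "((\<lambda>x. exp (2 * (f \<circ> inv_ch ?c) x) * (?H \<circ> inv_ch ?c) x) has_derivative
      (\<lambda>X. exp (2 * f p) * (2 * ?f X * h p v w + dir_deriv A p X ?H))) (at (map_ch ?c p))"
      by (rule derivative_eq_intros f' H refl)+ (simp add: atlas_inv[OF at c] Yp algebra_simps)
    then show ?thesis by (intro dir_derivI) (simp add: o_def)
  qed
  define S where "S X v = D' p X (Y v) - D p X (Y v) - ?f X *\<^sub>R v + ?f (J X) *\<^sub>R J v" for X v
  have "S X v = 0"
  proof (rule skew_torsion_free_imp_zero[where g = "h p" and S = S])
    show "linear (\<lambda>X. S X v)" for v
      by (rule linearI) (simp_all add: S_def linear_add[OF d(1)] linear_add[OF d'(1)]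
          linear_cmul[OF d(1)] linear_cmul[OF d'(1)] linear_add[OF lin_f] linear_cmul[OF lin_f]
          J_linear_simps algebra_simps)
    show "S X (J v) = J (S X v)" for X v
      by (simp add: S_def d(2) d'(2) J_linear_simps)
    \<comment> \<open>The correction \<open>C X v = df(X) v - df(J X) J v\<close> satisfies
      \<open>C (J X) v = J (C X v)\<close>, so it cancels in
      \<open>C X v + J (C (J X) v)\<close>.\<close>
    show "S v w + J (S (J v) w) = S w v + J (S (J w) v)" for v w
      using d(4)[of v w] d'(4)[of v w] linear_neg[OF lin_f]
      by (simp add: S_def J_linear_simps algebra_simps)
    show "h p (S X v) w + h p v (S X w) = 0" for X v w
    proof -
      \<comment> \<open>Since \<open>J\<close> is skew, the term with \<open>df(J X)\<close> does
        not affect compatibility with the metric. The term \<open>df(X) v\<close> alone accounts for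
        the summand \<open>2 df(X) h\<close> produced by differentiating
        \<open>exp (2 * f)\<close>.\<close>
      have "h p (J v) w + h p v (J w) = 0"
        using hJ[of v "J w"] bilinear_rneg[OF bil] by simp
      moreover have "exp (2 * f p) * (h p (D' p X (Y v)) w + h p v (D' p X (Y w))) =
          exp (2 * f p) * (2 * ?f X * h p v w + (h p (D p X (Y v)) w + h p v (D p X (Y w))))"
        using d'(3)[of X v w] unfolding metric' d(3) by (simp add: distrib_left)
      ultimately have "h p (D' p X (Y v)) w + h p v (D' p X (Y w))
          - (h p (D p X (Y v)) w + h p v (D p X (Y w)))
          - 2 * ?f X * h p v w + ?f (J X) * (h p (J v) w + h p v (J w)) = 0"
        by simp
      then show ?thesis
        by (simp add: S_def bilinear_ladd[OF bil] bilinear_radd[OF bil] bilinear_lsub[OF bil]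
            bilinear_rsub[OF bil] bilinear_lmul[OF bil] bilinear_rmul[OF bil] algebra_simps)
    qed
  qed (use bil pos hJ in auto)
  then show ?thesis by (simp add: S_def algebra_simps)
qed

section \<open>Charts of the twistor space and the pulled back connection\<close>

lemma complex_scaleR_J: "t *s v = Re t *\<^sub>R v + Im t *\<^sub>R J v"
  by (simp add: J_def vec_eq_iff complex_eq_iff)

lemma complex_linear_scale:
  assumes "linear L" "\<And>v. L (J v) = J (L v)"
  shows "L (t *s v) = t *s L v"
  by (simp add: complex_scaleR_J linear_add[OF assms(1)] linear_cmul[OF assms(1)] assms(2))

text \<open>Vectors of type (1,0) have the form \<open>a - \<surd>-1 J a\<close>, so they are
  determined by their real part. Through \<open>fst_cscale_T10\<close>, computations with them
  become computations with \<open>*s\<close> on real tangent vectors.\<close>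

lemma T10_iff: "w \<in> T10 \<longleftrightarrow> snd w = - J (fst w)"
  by (auto simp: T10_def cscale_def prod_eq_iff J_linear_simps)

lemma fst_cscale_T10: "w \<in> T10 \<Longrightarrow> fst (cscale t w) = t *s fst w"
  by (simp add: cscale_def T10_iff complex_scaleR_J)

lemma cscale_T10: "w \<in> T10 \<Longrightarrow> cscale t w \<in> T10"
  by (simp add: cscale_def T10_iff J_linear_simps)

lemma cscale_cscale: "cscale s (cscale t w) = cscale (s * t) w"
  by (simp add: cscale_def prod_eq_iff algebra_simps)

lemma cscale_1: "cscale 1 w = w"
  by (simp add: cscale_def)

lemma in_cline: "w \<in> cline w"
  unfolding cline_def by (rule range_eqI[where x = 1]) (simp add: cscale_1)

lemma cline_cscale:
  assumes "t \<noteq> 0"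
  shows "cline (cscale t w) = cline w"
proof -
  have "cscale s w = cscale (s / t) (cscale t w)" for s
    using assms by (simp add: cscale_cscale)
  then show ?thesis unfolding cline_def
    by (metis (no_types, lifting) cscale_cscale rangeI image_subset_iff subset_antisym)
qed

context
  fixes A :: "('m, complex ^ 2) chart set"
  assumes A: "complex_surface A"
begin

private lemma at: "smooth_atlas A" by (rule complex_surface_atlas[OF A])

lemma tcoord_scale:
  assumes "c \<in> A" "p \<in> dom_ch c"
  shows "tcoord A c p (t *s v) = t *s tcoord A c p v"
  using complex_linear_scale[OF linear_tcoord[OF at assms] tcoord_J[OF A assms]] .

text \<open>The factor 2 appears because the real and the imaginary part of a (1,0)-vector
  contribute equally to \<open>dz\<close>.\<close>

lemma dz_T10:
  assumes "c \<in> A" "p \<in> dom_ch c" "w \<in> T10"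
  shows "dz A c p j w = 2 * tcoord A c p (fst w) $ j"
  using assms tcoord_J[OF A assms(1,2)] linear_neg[OF linear_tcoord[OF at assms(1,2)]]
  by (simp add: dz_def T10_iff J_def)

lemma dz_cscale:
  assumes "c \<in> A" "p \<in> dom_ch c" "w \<in> T10"
  shows "dz A c p j (cscale t w) = t * dz A c p j w"
  using assms by (simp add: dz_T10 cscale_T10 fst_cscale_T10 tcoord_scale)

text \<open>Evaluates the \<open>THE\<close> in the fibre coordinate: \<open>dz\<close> is complex
  linear along the line, so a ratio computed from one generator serves the whole line.\<close>

lemma twistor_chart_dom:
  assumes "c \<in> A" "z \<in> dom_ch (twistor_chart A c j k)"
  obtains w where "snd z = cline w" "w \<in> T10" "fst z \<in> dom_ch c" "dz A c (fst z) j w \<noteq> 0"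
    "map_ch (twistor_chart A c j k) z = (map_ch c (fst z), dz A c (fst z) k w / dz A c (fst z) j w)"
proof -
  obtain w w' where w: "snd z = cline w" "w \<in> T10" "fst z \<in> dom_ch c"
    and w': "w' \<in> cline w" "dz A c (fst z) j w' \<noteq> 0"
    using assms(2) unfolding twistor_chart_def twistor_space_def by auto
  from w' obtain s where "w' = cscale s w" by (auto simp: cline_def)
  with w' have nz: "dz A c (fst z) j w \<noteq> 0" using assms w by (auto simp: dz_cscale)
  have "(THE t. \<forall>w'\<in>cline w. dz A c (fst z) k w' = t * dz A c (fst z) j w') =
      dz A c (fst z) k w / dz A c (fst z) j w"
  proof (rule the_equality)
    show "\<forall>w'\<in>cline w. dz A c (fst z) k w' =
        dz A c (fst z) k w / dz A c (fst z) j w * dz A c (fst z) j w'"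
      using w assms(1) nz by (auto simp: cline_def dz_cscale)
    fix t assume "\<forall>w'\<in>cline w. dz A c (fst z) k w' = t * dz A c (fst z) j w'"
    with in_cline[of w] nz show "t = dz A c (fst z) k w / dz A c (fst z) j w" by auto
  qed
  then have "map_ch (twistor_chart A c j k) z =
      (map_ch c (fst z), dz A c (fst z) k w / dz A c (fst z) j w)"
    using w(1) by (cases z) (simp add: twistor_chart_def)
  with that w nz show ?thesis by blast
qed

text \<open>Equal first components give the same base point. Equal ratios of homogeneous coordinates
  make the generators proportional, and \<open>tcoord\<close> loses no information because
  \<open>tvec\<close> inverts it.\<close>

lemma twistor_chart_inj:
  assumes c: "c \<in> A" and jk: "j \<noteq> k"
  shows "inj_on (map_ch (twistor_chart A c j k)) (dom_ch (twistor_chart A c j k))"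
proof (rule inj_onI)
  fix y z
  assume y: "y \<in> dom_ch (twistor_chart A c j k)" and z: "z \<in> dom_ch (twistor_chart A c j k)"
    and eq: "map_ch (twistor_chart A c j k) y = map_ch (twistor_chart A c j k) z"
  obtain v where v: "snd y = cline v" "v \<in> T10" "fst y \<in> dom_ch c" "dz A c (fst y) j v \<noteq> 0"
    "map_ch (twistor_chart A c j k) y = (map_ch c (fst y), dz A c (fst y) k v / dz A c (fst y) j v)"
    by (rule twistor_chart_dom[OF c y])
  obtain w where w: "snd z = cline w" "w \<in> T10" "fst z \<in> dom_ch c" "dz A c (fst z) j w \<noteq> 0"
    "map_ch (twistor_chart A c j k) z = (map_ch c (fst z), dz A c (fst z) k w / dz A c (fst z) j w)"
    by (rule twistor_chart_dom[OF c z])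
  define p where "p = fst z"
  have py: "fst y = p"
    using eq v w atlas_inj[OF at c] by (auto simp: p_def inj_on_def)
  define L where "L = tcoord A c p"
  have p: "p \<in> dom_ch c" using w by (simp add: p_def)
  have nz: "L (fst v) $ j \<noteq> 0" "L (fst w) $ j \<noteq> 0"
    and r: "L (fst v) $ k / L (fst v) $ j = L (fst w) $ k / L (fst w) $ j"
    using eq v w py p c unfolding p_def[symmetric] L_def by (auto simp: dz_T10)
  \<comment> \<open>The factor of proportionality is read off from the \<open>j\<close>-th
    coordinates, which do not vanish in this chart.\<close>
  define s where "s = L (fst v) $ j / L (fst w) $ j"
  have "L (fst v) $ i = s * L (fst w) $ i" for i
  proof -
    have "i = j \<or> i = k" using jk exhaust_2 by metis
    then show ?thesis using nz r by (auto simp: s_def field_simps)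
  qed
  then have "L (fst v) = L (s *s fst w)"
    using c p by (simp add: L_def tcoord_scale vec_eq_iff)
  then have "fst v = s *s fst w"
    unfolding L_def by (metis tvec_tcoord[OF at c p])
  then have "v = cscale s w"
    using v(2) w(2) cscale_T10[OF w(2)] by (simp add: prod_eq_iff T10_iff fst_cscale_T10)
  moreover have "s \<noteq> 0" using nz by (simp add: s_def)
  ultimately show "y = z"
    using v(1) w(1) py cline_cscale[of s w] by (auto intro: prod_eqI simp: p_def)
qed

lemma twistor_atlas_inj: "b \<in> twistor_atlas A \<Longrightarrow> inj_on (map_ch b) (dom_ch b)"
  unfolding twistor_atlas_def using twistor_chart_inj by blast

text \<open>In suitable charts the projection from the twistor space to the surface is the first
  projection of a product. Everything about \<open>fst\<close> as a map between manifolds is reduced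
  to this.\<close>

lemma twistor_atlas_base:
  assumes "b \<in> twistor_atlas A"
  shows "\<exists>c\<in>A. \<forall>z\<in>dom_ch b. fst z \<in> dom_ch c \<and> fst (map_ch b z) = map_ch c (fst z)"
proof -
  from assms obtain c j k where b: "b = twistor_chart A c j k" "c \<in> A"
    by (auto simp: twistor_atlas_def)
  have "fst z \<in> dom_ch c \<and> fst (map_ch b z) = map_ch c (fst z)" if "z \<in> dom_ch b" for z
    using that unfolding b(1) by (rule twistor_chart_dom[OF b(2)]) simp
  with b(2) show ?thesis by blast
qed

text \<open>Restricting to the part of \<open>W\<close> over a chart domain of the surface cuts its
  image in the chart \<open>b\<close> with a cylinder over an open set.\<close>

lemma twistor_open:
  assumes W: "openin (atlas_topology (twistor_atlas A)) W" and b: "b \<in> twistor_atlas A"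
    and e: "e \<in> A"
  shows "open (map_ch b ` (W \<inter> fst -` dom_ch e \<inter> dom_ch b))"
proof -
  obtain c where c: "c \<in> A" "\<And>z. z \<in> dom_ch b \<Longrightarrow> fst z \<in> dom_ch c"
    "\<And>z. z \<in> dom_ch b \<Longrightarrow> fst (map_ch b z) = map_ch c (fst z)"
    using twistor_atlas_base[OF b] by blast
  have "map_ch b ` (W \<inter> fst -` dom_ch e \<inter> dom_ch b) =
      map_ch b ` (W \<inter> dom_ch b) \<inter> (map_ch c ` (dom_ch c \<inter> dom_ch e)) \<times> UNIV" (is "?l = ?r")
  proof
    show "?l \<subseteq> ?r"
    proof
      fix x assume "x \<in> ?l"
      then obtain y where y: "x = map_ch b y" "y \<in> W" "y \<in> dom_ch b" "fst y \<in> dom_ch e" by auto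
      then have "fst x \<in> map_ch c ` (dom_ch c \<inter> dom_ch e)" using c by simp
      with y show "x \<in> ?r" by (simp add: mem_Times_iff)
    qed
    show "?r \<subseteq> ?l"
    proof
      fix x assume "x \<in> ?r"
      then have "x \<in> map_ch b ` (W \<inter> dom_ch b)" "fst x \<in> map_ch c ` (dom_ch c \<inter> dom_ch e)"
        by (simp_all add: mem_Times_iff)
      then obtain y q where y: "x = map_ch b y" "y \<in> W" "y \<in> dom_ch b"
        and q: "fst x = map_ch c q" "q \<in> dom_ch c" "q \<in> dom_ch e" by blast
      then have "fst y = q" using c(2,3) by (intro inj_onD[OF atlas_inj[OF at c(1)]]) simp_all
      then show "x \<in> ?l" using y q by auto
    qed
  qed
  moreover have "open (map_ch b ` (W \<inter> dom_ch b))"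
    using W b openin_atlas_topology[of "twistor_atlas A" W] twistor_atlas_inj by blast
  ultimately show ?thesis
    using atlas_open[OF at c(1) e] by (simp add: open_Int open_Times)
qed

text \<open>Pulling a smooth function back along the projection keeps it smooth, since in charts it
  is composed with the linear map \<open>fst\<close>.\<close>

lemma smooth_lift:
  assumes W: "openin (atlas_topology (twistor_atlas A)) W" and b: "b \<in> twistor_atlas A"
    and e: "e \<in> A" and g: "smooth_fun A (dom_ch e) g"
  shows "smooth_on (map_ch b ` (W \<inter> fst -` dom_ch e \<inter> dom_ch b)) (\<lambda>x. g (fst (inv_ch b x)))"
proof -
  obtain c where c: "c \<in> A" "\<And>z. z \<in> dom_ch b \<Longrightarrow> fst z \<in> dom_ch c"
    "\<And>z. z \<in> dom_ch b \<Longrightarrow> fst (map_ch b z) = map_ch c (fst z)"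
    using twistor_atlas_base[OF b] by blast
  let ?S = "map_ch b ` (W \<inter> fst -` dom_ch e \<inter> dom_ch b)"
  note S = twistor_open[OF W b e]
  have g': "smooth_on (map_ch c ` (dom_ch c \<inter> dom_ch e)) (g \<circ> inv_ch c)"
    using g c(1) unfolding smooth_fun_def by (metis Int_commute)
  have fst: "smooth_on ?S fst"
    unfolding smooth_on_def using Ck_on_linear_map[OF bounded_linear_fst S] ..
  have sub: "fst ` ?S \<subseteq> map_ch c ` (dom_ch c \<inter> dom_ch e)" using c by auto
  have "smooth_on ?S (\<lambda>x. (g \<circ> inv_ch c) (fst x))"
    by (rule smooth_on_compose[OF S atlas_open[OF at c(1) e] sub g' fst])
  moreover have "(g \<circ> inv_ch c) (fst x) = g (fst (inv_ch b x))" if "x \<in> ?S" for x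
    using that c by (auto simp: inv_ch_map_ch[OF twistor_atlas_inj[OF b]] atlas_inv[OF at])
  ultimately show ?thesis
    using smooth_on_cong[OF S, of "\<lambda>x. (g \<circ> inv_ch c) (fst x)"
        "\<lambda>x. g (fst (inv_ch b x))"] by blast
qed

lemma smooth_fun_map_ch:
  assumes "e \<in> A"
  shows "smooth_fun A (dom_ch e) (map_ch e)"
  using atlas_smooth[OF at _ assms] unfolding smooth_fun_def by (simp add: Int_commute)

lemma smooth_fun_uminus:
  assumes "smooth_fun A (carrier_of A) (f :: 'm \<Rightarrow> real)"
  shows "smooth_fun A (carrier_of A) (\<lambda>p. - f p)"
  unfolding smooth_fun_def smooth_on_def
proof (intro ballI allI)
  fix c k assume c: "c \<in> A"
  have *: "carrier_of A \<inter> dom_ch c = dom_ch c" using c by (auto simp: carrier_of_def)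
  have "Ck_on k (map_ch c ` dom_ch c) (\<lambda>x. - (f \<circ> inv_ch c) x)"
    using assms c unfolding smooth_fun_def smooth_on_def
    by (intro Ck_on_bounded_linear[OF bounded_linear_minus[OF bounded_linear_ident]
          atlas_open_dom[OF at c]]) (metis *)
  then show "Ck_on k (map_ch c ` (carrier_of A \<inter> dom_ch c)) ((\<lambda>p. - f p) \<circ> inv_ch c)"
    by (simp add: * o_def)
qed

lemma smooth_along_scale_exp:
  assumes W: "openin (atlas_topology (twistor_atlas A)) W"
    and f: "smooth_fun A (carrier_of A) f" and Y: "smooth_along (twistor_atlas A) A fst W Y"
  shows "smooth_along (twistor_atlas A) A fst W (\<lambda>y. exp (f (fst y)) *\<^sub>R Y y)"
  unfolding smooth_along_def smooth_fun_def
proof (intro ballI)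
  fix e b assume e: "e \<in> A" and b: "b \<in> twistor_atlas A"
  let ?S = "map_ch b ` (W \<inter> fst -` dom_ch e \<inter> dom_ch b)"
  note S = twistor_open[OF W b e]
  have "smooth_on ?S (\<lambda>x. f (fst (inv_ch b x)))"
    by (rule smooth_lift[OF W b e smooth_fun_subset[OF f]]) (use e in \<open>auto simp: carrier_of_def\<close>)
  then have "smooth_on ?S (\<lambda>x. exp (f (fst (inv_ch b x))))"
    unfolding smooth_on_def using Ck_on_exp[OF S] by blast
  moreover have "smooth_on ?S ((\<lambda>n. tcoord A e (fst n) (Y n)) \<circ> inv_ch b)"
    using Y e b unfolding smooth_along_def smooth_fun_def by blast
  ultimately have sm: "smooth_on ?S (\<lambda>x. exp (f (fst (inv_ch b x))) *\<^sub>R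
      ((\<lambda>n. tcoord A e (fst n) (Y n)) \<circ> inv_ch b) x)"
    unfolding smooth_on_def using Ck_on_bilinear[OF bounded_bilinear_scaleR S] by blast
  have "exp (f (fst (inv_ch b x))) *\<^sub>R ((\<lambda>n. tcoord A e (fst n) (Y n)) \<circ> inv_ch b) x =
      ((\<lambda>n. tcoord A e (fst n) (exp (f (fst n)) *\<^sub>R Y n)) \<circ> inv_ch b) x" if "x \<in> ?S" for x
    using that linear_cmul[OF linear_tcoord[OF at e]]
    by (auto simp: inv_ch_map_ch[OF twistor_atlas_inj[OF b]])
  with sm show "smooth_on ?S ((\<lambda>n. tcoord A e (fst n) (exp (f (fst n)) *\<^sub>R Y n)) \<circ> inv_ch b)"
    by (rule iffD1[OF smooth_on_cong[OF S], rotated])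
qed

text \<open>With \<open>V\<close> the projection of \<open>X\<close>, differentiating the factor
  \<open>exp (- f)\<close> contributes \<open>- df(V) Y\<close>, which cancels the term
  \<open>df(V) Y\<close> coming from the change of connection. What survives is the multiple of
  \<open>J (Y z)\<close>, which acts as an imaginary scalar on (1,0)-vectors.\<close>

lemma cov_along_conformal:
  assumes h: "hermitian_metric A h" and f: "smooth_fun A (carrier_of A) f"
    and D: "chern_connection A h D"
    and D': "chern_connection A (\<lambda>p X Y. exp (2 * f p) * h p X Y) D'"
    and W: "openin (atlas_topology (twistor_atlas A)) W" and z: "z \<in> W"
    and Y: "smooth_along (twistor_atlas A) A fst W Y"
  shows "cov_along (twistor_atlas A) A D' fst z X (\<lambda>y. exp (- f (fst y)) *\<^sub>R Y y) =
    exp (- f (fst z)) *\<^sub>R (cov_along (twistor_atlas A) A D fst z X Y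
      - dir_deriv A (fst z) (J (mderiv (twistor_atlas A) A fst z X)) f *\<^sub>R J (Y z))"
proof -
  define B where "B = twistor_atlas A"
  define b where "b = chart_at B z"
  define p where "p = fst z"
  define e where "e = chart_at A p"
  define V where "V = mderiv B A fst z X"
  define S where "S = map_ch b ` (W \<inter> fst -` dom_ch e \<inter> dom_ch b)"
  note W = W[folded B_def]
  have "z \<in> carrier_of B"
    using W z openin_atlas_topology[of B W] twistor_atlas_inj unfolding B_def by blast
  then have b: "b \<in> B" "z \<in> dom_ch b" unfolding b_def by (rule chart_at)+
  obtain c where c: "c \<in> A" "\<And>z. z \<in> dom_ch b \<Longrightarrow> fst z \<in> dom_ch c"
    using twistor_atlas_base[OF b(1)[unfolded B_def]] by blast
  have p: "p \<in> carrier_of A" using carrier_ofI[OF c(1) c(2)[OF b(2)]] by (simp add: p_def)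
  have e: "e \<in> A" "p \<in> dom_ch e" unfolding e_def by (rule chart_at[OF p])+
  have S: "open S" unfolding S_def by (rule twistor_open[OF W[unfolded B_def] b(1)[unfolded B_def] e(1)])
  define x0 where "x0 = map_ch b z"
  have x0: "x0 \<in> S" unfolding S_def x0_def using z e b by (auto simp: p_def)
  have inv: "inv_ch b (map_ch b y) = y" if "y \<in> dom_ch b" for y
    using that inv_ch_map_ch[OF twistor_atlas_inj] b(1) unfolding B_def by blast
  let ?G = "\<lambda>n. tcoord A e (fst n) (Y n)"
  have "smooth_on S (?G \<circ> inv_ch b)"
    using Y e(1) b(1) unfolding S_def B_def smooth_along_def smooth_fun_def by blast
  then have G: "((?G \<circ> inv_ch b) has_derivative (\<lambda>X. dir_deriv B z X ?G)) (at x0)"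
    unfolding dir_deriv_def b_def[symmetric] x0_def[symmetric]
    by (rule smooth_on_has_derivative[OF S _ x0])
  have "smooth_on S (\<lambda>x. map_ch e (fst (inv_ch b x)))"
    unfolding S_def
    by (rule smooth_lift[OF W[unfolded B_def] b(1)[unfolded B_def] e(1) smooth_fun_map_ch[OF e(1)]])
  then have P: "((map_ch e \<circ> fst \<circ> inv_ch b) has_derivative mderiv B A fst z) (at x0)"
    unfolding mderiv_def b_def[symmetric] x0_def[symmetric] p_def[symmetric] e_def[symmetric]
    using smooth_on_has_derivative[OF S _ x0] by (simp add: o_def)
  have Px0: "(map_ch e \<circ> fst \<circ> inv_ch b) x0 = map_ch e p"
    using inv[OF b(2)] by (simp add: x0_def p_def)
  have "((f \<circ> inv_ch e) has_derivative (\<lambda>X. dir_deriv A p X f)) (at (map_ch e p))"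
    unfolding e_def by (rule dir_deriv_has_derivative[OF at p f])
      (use e in \<open>auto simp: carrier_of_def e_def\<close>)
  \<comment> \<open>Factoring the pulled back function through the chart \<open>e\<close> of the
    surface turns its derivative along \<open>X\<close> into that of \<open>f\<close> along the
    projected vector.\<close>
  from diff_chain_at[OF P this[folded Px0]]
  have F: "((f \<circ> inv_ch e \<circ> (map_ch e \<circ> fst \<circ> inv_ch b)) has_derivative
      (\<lambda>X. dir_deriv A p (mderiv B A fst z X) f)) (at x0)"
    by (simp add: o_def)
  let ?F = "f \<circ> inv_ch e \<circ> (map_ch e \<circ> fst \<circ> inv_ch b)"
  have "((\<lambda>x. exp (- ?F x) *\<^sub>R (?G \<circ> inv_ch b) x) has_derivative
      (\<lambda>X. exp (- f p) *\<^sub>R (dir_deriv B z X ?G -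
        dir_deriv A p (mderiv B A fst z X) f *\<^sub>R Y z))) (at x0)"
    by (rule derivative_eq_intros F G refl)+
      (simp add: x0_def inv[OF b(2)] p_def[symmetric] atlas_inv[OF at e] algebra_simps
        tcoord_chart_at[OF at p, folded e_def])
  then have "((\<lambda>n. tcoord A e (fst n) (exp (- f (fst n)) *\<^sub>R Y n)) \<circ> inv_ch b has_derivative
      (\<lambda>X. exp (- f p) *\<^sub>R (dir_deriv B z X ?G -
        dir_deriv A p (mderiv B A fst z X) f *\<^sub>R Y z))) (at x0)"
    by (rule has_derivative_transform_within_open[OF _ S x0])
      (auto simp: S_def inv atlas_inv[OF at e(1)] linear_cmul[OF linear_tcoord[OF at e(1)]])
  then have 1: "dir_deriv B z X (\<lambda>n. tcoord A e (fst n) (exp (- f (fst n)) *\<^sub>R Y n)) =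
      exp (- f p) *\<^sub>R (dir_deriv B z X ?G - dir_deriv A p V f *\<^sub>R Y z)"
    unfolding V_def x0_def b_def by (rule dir_derivI)
  \<comment> \<open>The basis fields in \<open>cov_along\<close> are the fields
    \<open>coord_field A p a\<close>, so the pointwise comparison of the connections applies to each
    summand.\<close>
  have "D' p V (\<lambda>q. tvec A e q a) =
      D p V (\<lambda>q. tvec A e q a) + dir_deriv A p V f *\<^sub>R a - dir_deriv A p (J V) f *\<^sub>R J a" for a
    using chern_connection_conformal[OF _ f D D' p, of V a] A h
    by (simp add: coord_field_def[abs_def] e_def hermitian_surface_def)
  then have 2: "(\<Sum>a\<in>Basis. (Y z \<bullet> a) *\<^sub>R D' p V (\<lambda>q. tvec A e q a)) =
      (\<Sum>a\<in>Basis. (Y z \<bullet> a) *\<^sub>R D p V (\<lambda>q. tvec A e q a))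
      + dir_deriv A p V f *\<^sub>R Y z - dir_deriv A p (J V) f *\<^sub>R J (Y z)"
    by (subst (3 4) euclidean_representation[symmetric, of "Y z"])
      (simp add: linear_sum[OF linear_J] J_linear_simps scaleR_sum_right scaleR_add_right
        scaleR_diff_right sum.distrib sum_subtractf mult.commute)
  have 3: "(\<Sum>a\<in>Basis. ((r *\<^sub>R Y z) \<bullet> a) *\<^sub>R D' p V (\<lambda>q. tvec A e q a)) =
      r *\<^sub>R (\<Sum>a\<in>Basis. (Y z \<bullet> a) *\<^sub>R D' p V (\<lambda>q. tvec A e q a))" for r
    by (simp add: scaleR_sum_right)
  show ?thesis
    unfolding cov_along_def Let_def p_def[symmetric] B_def[symmetric] e_def[symmetric]
      V_def[symmetric] 1 3 2
    by (simp add: algebra_simps)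
qed

end

section \<open>Unitary frames and the forms on the twistor space\<close>

lemma scaleR_eq_cscale: "r *\<^sub>R w = cscale (complex_of_real r) w"
  by (simp add: cscale_def prod_eq_iff)

lemma cscale_scaleR: "cscale t (r *\<^sub>R w) = r *\<^sub>R cscale t w"
  by (simp add: scaleR_eq_cscale cscale_cscale mult.commute)

lemma cscale_add_left: "cscale (s + t) w = cscale s w + cscale t w"
  by (simp add: cscale_def prod_eq_iff algebra_simps)

lemma cscale_ii_T10: "w \<in> T10 \<Longrightarrow> cscale \<i> w = (J (fst w), J (snd w))"
  by (simp add: T10_def)

lemma unitary_frames_T10:
  assumes "u \<in> unitary_frames h p"
  shows "fst u \<in> T10" "snd u \<in> T10"
  using assms by (auto simp: unitary_frames_def T10_iff cscale_def J_linear_simps)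

lemma unitary_frames_independent:
  assumes u: "u \<in> unitary_frames h p" and bil: "bilinear (h p)"
    and zero: "s *s fst (fst u) + t *s fst (snd u) = 0"
  shows "s = 0 \<and> t = 0"
proof -
  obtain e1 e2 e3 e4 where e: "u = (cscale (1 / sqrt 2) (e1, - e2), cscale (1 / sqrt 2) (e3, - e4))"
    "e2 = J e1" "e4 = J e3"
    and h: "\<forall>i<4. \<forall>j<4. h p ([e1, e2, e3, e4] ! i) ([e1, e2, e3, e4] ! j) = (if i = j then 1 else 0)"
    using u unfolding unitary_frames_def by blast
  \<comment> \<open>Up to the factor \<open>sqrt 2\<close> this is the real part of the complex
    combination of the frame. Pairing it with the orthonormal vectors recovers the four real
    coefficients.\<close>
  define x where "x = Re s *\<^sub>R e1 + Im s *\<^sub>R e2 + Re t *\<^sub>R e3 + Im t *\<^sub>R e4"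
  have "s *s fst (fst u) + t *s fst (snd u) = (1 / sqrt 2) *\<^sub>R x"
    by (simp add: e x_def cscale_def complex_scaleR_J J_linear_simps algebra_simps)
  then have x: "x = 0" using zero by simp
  have "h p x e1 = Re s" "h p x e2 = Im s" "h p x e3 = Re t" "h p x e4 = Im t"
    using h by (simp_all add: x_def bilinear_ladd[OF bil] bilinear_lmul[OF bil]
        numeral_eq_Suc All_less_Suc)
  then show ?thesis by (simp add: x bilinear_lzero[OF bil] complex_eq_iff)
qed

lemma unitary_frames_spanning:
  assumes "u \<in> unitary_frames h p" "bilinear (h p)"
  shows "\<exists>s t. v = s *s fst (fst u) + t *s fst (snd u)"
proof -
  define L where "L x = x $ 1 *s fst (fst u) + x $ 2 *s fst (snd u)" for x :: "complex ^ 2"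
  have lin: "linear L"
    by (rule linearI)
      (auto simp: L_def vec_eq_iff algebra_simps scaleR_conv_of_real[where 'a=complex])
  have "inj L"
    unfolding linear_injective_0[OF lin]
  proof (intro allI impI)
    fix x assume "L x = 0"
    then have "x $ 1 = 0 \<and> x $ 2 = 0"
      unfolding L_def by (rule unitary_frames_independent[OF assms])
    then show "x = 0" by (simp add: vec_eq_iff forall_2)
  qed
  then have "surj L" by (rule linear_injective_imp_surjective[OF lin _ refl])
  then obtain x where "v = L x" by (rule surjE)
  then show ?thesis unfolding L_def by blast
qed

lemma unitary_frames_cong:
  assumes "u \<in> unitary_frames h p" "bilinear (h p)"
    and "s *s fst (fst u) + t *s fst (snd u) = s' *s fst (fst u) + t' *s fst (snd u)"
  shows "s = s' \<and> t = t'"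
proof -
  have "(s - s') *s fst (fst u) + (t - t') *s fst (snd u) = 0"
    using assms(3) by (simp add: vec_eq_iff algebra_simps)
  from unitary_frames_independent[OF assms(1,2) this] show ?thesis by simp
qed

lemma unitary_frames_scale:
  assumes "u \<in> unitary_frames h p" and bil: "bilinear (h p)"
  shows "exp (- f p) *\<^sub>R u \<in> unitary_frames (\<lambda>p X Y. exp (2 * f p) * h p X Y) p"
proof -
  obtain e1 e2 e3 e4 where e: "u = (cscale (1 / sqrt 2) (e1, - e2), cscale (1 / sqrt 2) (e3, - e4))"
    "e2 = J e1" "e4 = J e3"
    and on: "\<forall>i<4. \<forall>j<4. h p ([e1, e2, e3, e4] ! i) ([e1, e2, e3, e4] ! j) = (if i = j then 1 else 0)"
    using assms(1) unfolding unitary_frames_def by blast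
  let ?r = "exp (- f p)"
  let ?e = "map ((*\<^sub>R) ?r) [e1, e2, e3, e4]"
  have "exp (2 * f p) * h p (?e ! i) (?e ! j) = (if i = j then 1 else 0)" if "i < 4" "j < 4" for i j
  proof -
    have "h p (?e ! i) (?e ! j) = ?r * (?r * h p ([e1, e2, e3, e4] ! i) ([e1, e2, e3, e4] ! j))"
      using that by (subst (1 2) nth_map) (simp_all add: bilinear_lmul[OF bil] bilinear_rmul[OF bil])
    moreover have "exp (2 * f p) * (?r * ?r) = 1" by (simp add: exp_add[symmetric])
    ultimately show ?thesis using on that by (simp add: mult.assoc[symmetric])
  qed
  moreover have u': "?r *\<^sub>R u = (cscale (1 / sqrt 2) (?r *\<^sub>R e1, - (?r *\<^sub>R e2)),
      cscale (1 / sqrt 2) (?r *\<^sub>R e3, - (?r *\<^sub>R e4)))"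
    by (simp add: e cscale_scaleR[symmetric])
  moreover have "?r *\<^sub>R e2 = J (?r *\<^sub>R e1)" "?r *\<^sub>R e4 = J (?r *\<^sub>R e3)"
    by (simp_all add: e J_linear_simps)
  ultimately show ?thesis
    unfolding unitary_frames_def u' mem_Collect_eq list.map
    by (intro exI[of _ "?r *\<^sub>R e1"] exI[of _ "?r *\<^sub>R e2"]
        exI[of _ "?r *\<^sub>R e3"] exI[of _ "?r *\<^sub>R e4"])
      simp
qed

text \<open>A (1,0)-vector plus its conjugate is twice its real part. The defining equation of
  \<open>phi12\<close> therefore holds automatically in the imaginary component, and its real
  component has unique coefficients because the frame is independent over the complex
  numbers.\<close>

lemma phi12_eq:
  assumes u: "u z \<in> unitary_frames h p" and bil: "bilinear (h p)"
    and eq: "mderiv (twistor_atlas A) A fst z X =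
      2 *\<^sub>R (t1 *s fst (fst (u z)) + t2 *s fst (snd (u z)))"
  shows "phi12 A u z X = (t1, t2)"
proof -
  note T = unitary_frames_T10[OF u]
  have *: "(v, 0) = cscale s (fst (u z)) + cscale t (snd (u z)) +
       (cscale (cnj s) (cconj (fst (u z))) + cscale (cnj t) (cconj (snd (u z)))) \<longleftrightarrow>
      v = 2 *\<^sub>R (s *s fst (fst (u z)) + t *s fst (snd (u z)))" for v s t
  proof -
    have "cscale s w + cscale (cnj s) (cconj w) = (2 *\<^sub>R (s *s fst w), 0)" if "w \<in> T10" for s w
      using that by (simp add: prod_eq_iff cscale_def cconj_def T10_iff complex_scaleR_J scaleR_2)
    note pair = this[OF T(1), of s] this[OF T(2), of t]
    have "cscale s (fst (u z)) + cscale t (snd (u z)) +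
        (cscale (cnj s) (cconj (fst (u z))) + cscale (cnj t) (cconj (snd (u z)))) =
        (cscale s (fst (u z)) + cscale (cnj s) (cconj (fst (u z)))) +
        (cscale t (snd (u z)) + cscale (cnj t) (cconj (snd (u z))))"
      by (simp only: add_ac)
    then show ?thesis unfolding pair by (simp add: scaleR_add_right)
  qed
  show ?thesis
    unfolding phi12_def * eq
  proof (rule the_equality)
    fix x assume "case x of (s, t) \<Rightarrow> 2 *\<^sub>R (t1 *s fst (fst (u z)) + t2 *s fst (snd (u z))) =
      2 *\<^sub>R (s *s fst (fst (u z)) + t *s fst (snd (u z)))"
    then have "t1 *s fst (fst (u z)) + t2 *s fst (snd (u z)) =
        fst x *s fst (fst (u z)) + snd x *s fst (snd (u z))"
      by (simp add: case_prod_beta)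
    from unitary_frames_cong[OF u bil this] show "x = (t1, t2)" by (simp add: prod_eq_iff)
  qed simp
qed

text \<open>The projected vector does not depend on the frame, so shrinking the frame by
  \<open>exp (- r)\<close> enlarges its coefficients by the inverse factor.\<close>

lemma phi12_scale:
  assumes u: "u z \<in> unitary_frames h p" and bil: "bilinear (h p)"
    and u': "u' z = exp (- r) *\<^sub>R u z" "u' z \<in> unitary_frames h' p" and bil': "bilinear (h' p)"
  shows "phi1 A u' z X = exp (complex_of_real r) * phi1 A u z X"
    and "phi2 A u' z X = exp (complex_of_real r) * phi2 A u z X"
proof -
  obtain s t where st: "(1 / 2) *\<^sub>R mderiv (twistor_atlas A) A fst z X =
      s *s fst (fst (u z)) + t *s fst (snd (u z))"
    using unitary_frames_spanning[OF u bil] by blast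
  have 1: "mderiv (twistor_atlas A) A fst z X = 2 *\<^sub>R (s *s fst (fst (u z)) + t *s fst (snd (u z)))"
    unfolding st[symmetric] by simp
  have *: "(exp (complex_of_real r) * t) *s (exp (- r) *\<^sub>R a) = t *s a" for t and a :: "complex ^ 2"
    by (simp add: vec_eq_iff scaleR_conv_of_real[where 'a=complex] exp_of_real exp_minus)
  have 2: "mderiv (twistor_atlas A) A fst z X =
      2 *\<^sub>R ((exp (complex_of_real r) * s) *s fst (fst (u' z)) +
        (exp (complex_of_real r) * t) *s fst (snd (u' z)))"
    unfolding 1 by (simp add: u'(1) *)
  show "phi1 A u' z X = exp (complex_of_real r) * phi1 A u z X"
    and "phi2 A u' z X = exp (complex_of_real r) * phi2 A u z X"
    unfolding phi1_def phi2_def phi12_eq[of u, OF u bil 1] phi12_eq[of u', OF u'(2) bil' 2] by simp_all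
qed

text \<open>No existence is needed: if the equation has no solution, both descriptions denote the
  same junk value.\<close>

lemma fst_The_shift:
  assumes "\<And>s t s' t'. P s t \<Longrightarrow> P s' t' \<Longrightarrow> s = s' \<and> t = t'"
  shows "fst (THE (s, t). P s (t + k)) = fst (THE (s, t :: 'a :: group_add). P s t)"
proof (cases "\<exists>s t. P s t")
  case True
  then obtain s t where st: "P s t" by blast
  have "(THE (s, t). P s t) = (s, t)"
    by (rule the_equality) (use st assms in auto)
  moreover have "(THE (s, t). P s (t + k)) = (s, t - k)"
  proof (rule the_equality)
    fix x assume "case x of (s, t) \<Rightarrow> P s (t + k)"
    then have "P (fst x) (snd x + k)" by (simp add: case_prod_beta)
    from assms[of "fst x" "snd x + k" s t, OF this st]
    show "x = (s, t - k)" by (auto simp: prod_eq_iff algebra_simps)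
  qed (use st in simp)
  ultimately show ?thesis by simp
qed simp

section \<open>Rescaled local sections and the invariance of the forms\<close>

lemma local_section_base:
  assumes A: "complex_surface A" and u: "local_section A h W u" and z: "z \<in> W"
  shows "fst z \<in> carrier_of A"
proof -
  have "z \<in> carrier_of (twistor_atlas A)"
    using u z openin_atlas_topology[OF twistor_atlas_inj[OF A], of "twistor_atlas A" W]
    unfolding local_section_def by blast
  then obtain b where b: "b \<in> twistor_atlas A" "z \<in> dom_ch b" by (auto simp: carrier_of_def)
  show ?thesis
    using twistor_atlas_base[OF A b(1)] b(2) by (auto simp: carrier_of_def)
qed

lemma bilinear_conformal: "bilinear g \<Longrightarrow> bilinear (\<lambda>X Y. (r :: real) * g X Y)"
  by (auto simp: bilinear_def linear_iff algebra_simps)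

text \<open>Scaling a frame by a positive number keeps the line spanned by its first vector, and the
  factor \<open>exp (- f)\<close> restores unit length for the new metric. The rescaled frame field
  is thus a section over the same \<open>W\<close>.\<close>

lemma local_section_conformal:
  assumes A: "complex_surface A" and f: "smooth_fun A (carrier_of A) f"
    and bil: "\<And>p. p \<in> carrier_of A \<Longrightarrow> bilinear (h p)" and u: "local_section A h W u"
  shows "local_section A (\<lambda>p X Y. exp (2 * f p) * h p X Y) W (\<lambda>z. exp (- f (fst z)) *\<^sub>R u z)"
proof -
  note base = local_section_base[OF A u]
  note u = u[unfolded local_section_def]
  have W: "openin (atlas_topology (twistor_atlas A)) W" using u by blast
  have sm: "smooth_along (twistor_atlas A) A fst W (\<lambda>z. exp (- f (fst z)) *\<^sub>R Y z)"
    if "smooth_along (twistor_atlas A) A fst W Y" for Y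
    using smooth_along_scale_exp[OF A W smooth_fun_uminus[OF A f] that] .
  show ?thesis
    unfolding local_section_def
  proof (intro conjI ballI)
    fix z assume "z \<in> W"
    note bil = bil[OF base[OF this]]
    from \<open>z \<in> W\<close> u have "u z \<in> unitary_frames h (fst z)" "cline (fst (u z)) = snd z" by auto
    then show "exp (- f (fst z)) *\<^sub>R u z \<in>
        unitary_frames (\<lambda>p X Y. exp (2 * f p) * h p X Y) (fst z)"
      and "cline (fst (exp (- f (fst z)) *\<^sub>R u z)) = snd z"
      by (simp_all add: unitary_frames_scale bil scaleR_eq_cscale[of _ "fst (u z)"] cline_cscale)
  next
    fix s :: "ctan \<times> ctan \<Rightarrow> complex ^ 2"
    assume s: "s \<in> {fst \<circ> fst, snd \<circ> fst, fst \<circ> snd, snd \<circ> snd}"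
    then have "s (r *\<^sub>R x) = r *\<^sub>R s x" for r x by auto
    moreover have "smooth_along (twistor_atlas A) A fst W (\<lambda>z. s (u z))" using u s by blast
    ultimately show "smooth_along (twistor_atlas A) A fst W (\<lambda>z. s (exp (- f (fst z)) *\<^sub>R u z))"
      using sm by simp
  qed (rule W)
qed

text \<open>The equation defining the coefficients for the new connection and frame is the old one
  with the second unknown shifted by \<open>k\<close>. \<open>phi3\<close> is the first unknown, so
  it keeps its value.\<close>

lemma phi3_conformal:
  assumes surf: "hermitian_surface A h" and f: "smooth_fun A (carrier_of A) f"
    and D: "chern_connection A h D"
    and D': "chern_connection A (\<lambda>p X Y. exp (2 * f p) * h p X Y) D'"
    and u: "local_section A h W u" and z: "z \<in> W" and bil: "bilinear (h (fst z))"
  shows "phi3 A D' (\<lambda>z. exp (- f (fst z)) *\<^sub>R u z) z X = phi3 A D u z X"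
proof -
  have A: "complex_surface A" and h: "hermitian_metric A h"
    using surf unfolding hermitian_surface_def by auto
  note u' = u[unfolded local_section_def]
  have W: "openin (atlas_topology (twistor_atlas A)) W" using u' by blast
  have uz: "u z \<in> unitary_frames h (fst z)" using u' z by blast
  note T = unitary_frames_T10[OF uz]
  have sm: "smooth_along (twistor_atlas A) A fst W (\<lambda>z. fst (snd (u z)))"
    "smooth_along (twistor_atlas A) A fst W (\<lambda>z. snd (snd (u z)))"
    using u' by (simp_all add: o_def)
  \<comment> \<open>On (1,0)-vectors \<open>J\<close> acts as multiplication by \<open>\<i>\<close>,
    so the surviving correction from \<open>cov_along_conformal\<close> is the scalar
    \<open>k\<close> times the second frame vector.\<close>
  define k where "k = \<i> * complex_of_real
    (dir_deriv A (fst z) (J (mderiv (twistor_atlas A) A fst z X)) f)"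
  let ?C = "ccov A D z X (\<lambda>y. snd (u y))" and ?u1 = "fst (u z)" and ?u2 = "snd (u z)"
  define r where "r = exp (- f (fst z))"
  have "r \<noteq> 0" by (simp add: r_def)
  have k: "cscale k ?u2 = dir_deriv A (fst z) (J (mderiv (twistor_atlas A) A fst z X)) f *\<^sub>R
      (J (fst ?u2), J (snd ?u2))"
    unfolding k_def cscale_ii_T10[OF T(2), symmetric]
    by (simp add: scaleR_eq_cscale cscale_cscale mult.commute)
  have C': "ccov A D' z X (\<lambda>y. snd (exp (- f (fst y)) *\<^sub>R u y)) = r *\<^sub>R (?C - cscale k ?u2)"
    using cov_along_conformal[OF A h f D D' W z sm(1), of X]
      cov_along_conformal[OF A h f D D' W z sm(2), of X]
    by (simp add: ccov_def r_def k)
  \<comment> \<open>The common factor \<open>r\<close> cancels, and the correction moves to the side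
    of the unknowns.\<close>
  have "r *\<^sub>R (?C - cscale k ?u2) = cscale s (fst (r *\<^sub>R u z)) + cscale t (snd (r *\<^sub>R u z)) \<longleftrightarrow>
      ?C = cscale s ?u1 + cscale (t + k) ?u2" for s t
  proof -
    have "cscale s (fst (r *\<^sub>R u z)) + cscale t (snd (r *\<^sub>R u z)) = r *\<^sub>R (cscale s ?u1 + cscale t ?u2)"
      by (simp add: cscale_scaleR scaleR_add_right)
    then show ?thesis using \<open>r \<noteq> 0\<close> by (simp add: cscale_add_left diff_eq_eq add.assoc)
  qed
  then have "phi3 A D' (\<lambda>z. exp (- f (fst z)) *\<^sub>R u z) z X =
      fst (THE (s, t). ?C = cscale s ?u1 + cscale (t + k) ?u2)"
    unfolding phi3_def C' r_def[symmetric] by simp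
  also have "\<dots> = phi3 A D u z X"
    unfolding phi3_def
  proof (rule fst_The_shift)
    fix s t s' t'
    assume "?C = cscale s ?u1 + cscale t ?u2" "?C = cscale s' ?u1 + cscale t' ?u2"
    then have "fst (cscale s ?u1 + cscale t ?u2) = fst (cscale s' ?u1 + cscale t' ?u2)" by simp
    then show "s = s' \<and> t = t'"
      using unitary_frames_cong[OF uz bil] by (simp add: fst_cscale_T10 T)
  qed
  finally show ?thesis .
qed

text \<open>Each form is multiplied by a nonzero number, and the condition
  \<open>\<alpha> Y = \<i> * \<alpha> X\<close> is homogeneous in \<open>\<alpha>\<close>.\<close>

lemma basis10_conformal:
  assumes surf: "hermitian_surface A h" and f: "smooth_fun A (carrier_of A) f"
    and D: "chern_connection A h D"
    and D': "chern_connection A (\<lambda>p X Y. exp (2 * f p) * h p X Y) D'"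
    and z: "z \<in> W" and u: "local_section A h W u"
  shows "(\<forall>\<alpha>\<in>basis10 i A D' (\<lambda>z. exp (- f (fst z)) *\<^sub>R u z) z. \<alpha> Y = \<i> * \<alpha> X) \<longleftrightarrow>
    (\<forall>\<alpha>\<in>basis10 i A D u z. \<alpha> Y = \<i> * \<alpha> X)"
proof -
  have A: "complex_surface A" using surf unfolding hermitian_surface_def by auto
  let ?h' = "\<lambda>p X Y. exp (2 * f p) * h p X Y"
  let ?u' = "\<lambda>z. exp (- f (fst z)) *\<^sub>R u z"
  have bils: "bilinear (h p)" if "p \<in> carrier_of A" for p
    using surf that unfolding hermitian_surface_def hermitian_metric_def by blast
  note bil = bils[OF local_section_base[OF A u z]]
  note bil' = bilinear_conformal[OF bil]
  have "local_section A ?h' W ?u'" by (rule local_section_conformal[OF A f bils u])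
  then have uz: "u z \<in> unitary_frames h (fst z)" "?u' z \<in> unitary_frames ?h' (fst z)"
    using u z unfolding local_section_def by blast+
  note phi = phi12_scale[of u z h "fst z" ?u' "f (fst z)" ?h' A, OF uz(1) bil refl uz(2) bil']
    phi3_conformal[OF surf f D D' u z bil]
  have "exp (complex_of_real (f (fst z))) * a = \<i> * (exp (complex_of_real (f (fst z))) * b) \<longleftrightarrow> a = \<i> * b"
    for a b by (simp add: mult.left_commute)
  \<comment> \<open>The factor is real, so it passes through the conjugations that distinguish the
    four structures.\<close>
  moreover have "cnj (exp (complex_of_real (f (fst z))) * a) = exp (complex_of_real (f (fst z))) * cnj a" for a
    by (simp add: exp_cnj)
  ultimately show ?thesis unfolding basis10_def by (simp add: phi)
qed

theorem proposition4p3: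
  fixes A :: "('m, complex ^ 2) chart set" and h :: "'m metric" and f :: "'m \<Rightarrow> real"
    and D D' :: "('m, complex ^ 2) conn" and i :: nat
  assumes "hermitian_surface A h"
    and "smooth_fun A (carrier_of A) f"
    and "chern_connection A h D"
    and "chern_connection A (\<lambda>p X Y. exp (2 * f p) * h p X Y) D'"
    and "i \<in> {1, 2, 3, 4}"
  shows "\<forall>z \<in> twistor_space A. \<forall>X.
    twistor_acs i A (\<lambda>p X Y. exp (2 * f p) * h p X Y) D' z X = twistor_acs i A h D z X"
proof (intro ballI allI)
  fix z X
  let ?h' = "\<lambda>p X Y. exp (2 * f p) * h p X Y"
  have A: "complex_surface A" using assms(1) unfolding hermitian_surface_def by auto
  have bil: "bilinear (h p)" if "p \<in> carrier_of A" for p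
    using assms(1) that unfolding hermitian_surface_def hermitian_metric_def by blast
  note basis = basis10_conformal[OF assms(1-4), of z _ _ i]
  \<comment> \<open>Both almost complex structures are a \<open>THE\<close> over \<open>Y\<close>,
    so it suffices that the two conditions are equivalent for each \<open>Y\<close>.\<close>
  have "(\<forall>W u. z \<in> W \<and> local_section A ?h' W u \<longrightarrow> (\<forall>\<alpha>\<in>basis10 i A D' u z. \<alpha> Y = \<i> * \<alpha> X)) \<longleftrightarrow>
    (\<forall>W u. z \<in> W \<and> local_section A h W u \<longrightarrow> (\<forall>\<alpha>\<in>basis10 i A D u z. \<alpha> Y = \<i> * \<alpha> X))"
    (is "?P' \<longleftrightarrow> ?P") for Y
  proof
    assume P': ?P'
    show ?P
    proof (intro allI impI, elim conjE)
      fix W u assume "z \<in> W" and u: "local_section A h W u"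
      with P' local_section_conformal[OF A assms(2) bil u]
      show "\<forall>\<alpha>\<in>basis10 i A D u z. \<alpha> Y = \<i> * \<alpha> X"
        unfolding basis[OF \<open>z \<in> W\<close> u, symmetric] by blast
    qed
  next
    assume P: ?P
    show ?P'
    proof (intro allI impI, elim conjE)
      fix W u' assume "z \<in> W" and u': "local_section A ?h' W u'"
      \<comment> \<open>A section for the new metric is scaled back: the conformal change of
        \<open>?h'\<close> by \<open>- f\<close> is \<open>h\<close>. Rescaling \<open>?u\<close>
        then returns \<open>u'\<close>, so the comparison from \<open>h\<close> to
        \<open>?h'\<close> covers every section for \<open>?h'\<close>.\<close>
      let ?u = "\<lambda>z. exp (f (fst z)) *\<^sub>R u' z"
      have h: "(\<lambda>p X Y. exp (2 * - f p) * ?h' p X Y) = h"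
        by (simp add: fun_eq_iff mult.assoc[symmetric] exp_add[symmetric])
      have u: "local_section A h W ?u"
        using local_section_conformal[OF A smooth_fun_uminus[OF A assms(2)]
            bilinear_conformal[OF bil] u']
        unfolding h by simp
      have u'_eq: "(\<lambda>z. exp (- f (fst z)) *\<^sub>R ?u z) = u'"
        by (simp add: exp_add[symmetric])
      have "\<forall>\<alpha>\<in>basis10 i A D ?u z. \<alpha> Y = \<i> * \<alpha> X"
        using P u \<open>z \<in> W\<close> by blast
      then show "\<forall>\<alpha>\<in>basis10 i A D' u' z. \<alpha> Y = \<i> * \<alpha> X"
        unfolding basis[OF \<open>z \<in> W\<close> u, symmetric] u'_eq .
    qed
  qed
  then show "twistor_acs i A ?h' D' z X = twistor_acs i A h D z X"
    unfolding twistor_acs_def by presburger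
qed

end
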